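(* Let $X$ be a $\kappa$-metrizable compactum and let $Y$ be a space co-absolute to $X$. Then $Y$ is skeletally generated.
   Context: All spaces are Tychonoff and all maps are continuous. A compactum is a compact Hausdorff space. Two spaces are co-absolute if their absolutes are homeomorphic (the absolute of $X$ is the extremally disconnected Tychonoff space, unique up to homeomorphism, that admits a perfect irreducible map onto $X$). For two maps $\phi_1,\phi_2$ with domain $X$, write $\phi_1\prec\phi_2$ if there is a map $\phi\colon\phi_1(X)\to\phi_2(X)$ with $\phi_2=\phi\circ\phi_1$; maps $\phi_1,\phi_2$ are identified, written $\phi_1=\phi_2$, when such a $\phi$ is a homeomorphism. $\kappa$-metrizable compacta (in the sense of Shchepin) can be characterized as the compacta $X$ possessing a lattice of open maps, i.e. a family $\Psi$ of open maps with domain $X$ (regarded as maps onto their images) such that: (L1) for any map $f\colon X\to f(X)$ there exists $\phi\in\Psi$ with $\phi\prec f$ and $w(\phi(X))\le w(f(X))$, where $w$ denotes the weight, taken to be an infinite cardinal (the least infinite cardinal $\kappa$ such that the space has a base of cardinality at most $\kappa$); (L2) if $\{\phi_\alpha:\alpha\in A\}\subset\Psi$ is such that the diagonal product $\triangle\{\phi_{\alpha_i}:i=1,\dots,k\}$ belongs to $\Psi$ for any finitely many $\alpha_1,\dots,\alpha_k\in A$, then $\triangle\{\phi_\alpha:\alpha\in A\}\in\Psi$. A map $f\colon X\to Y$ is skeletal if the interior in $Y$ of the closure in $Y$ of $f(U)$ is non-empty for every non-empty open $U\subset X$. A space $X$ is skeletally generated if there exists an inverse system $S=\{X_\alpha,p^\beta_\alpha,A\}$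 of separable metric spaces $X_\alpha$ such that: (1) all bonding maps $p^\beta_\alpha$ are surjective and skeletal; (2) the index set $A$ is $\sigma$-complete (every countable chain in $A$ has a supremum in $A$); (3) for every countable chain $\{\alpha_n:n\ge 1\}\subset A$ with $\beta=\sup\{\alpha_n:n\ge1\}$ the space $X_\beta$ is a (dense) subset of $\varprojlim\{X_{\alpha_n},p^{\alpha_{n+1}}_{\alpha_n}\}$; (4) $X$ is embedded in $\varprojlim S$ such that $p_\alpha(X)=X_\alpha$ for each $\alpha\in A$, where $p_\alpha\colon\varprojlim S\to X_\alpha$ is the $\alpha$-th limit projection; (5) for every bounded continuous real-valued function $f$ on $X$ there exists $\alpha\in A$ such that $p_\alpha\prec f$ (with $p_\alpha$ restricted to $X$). *)

theory Defs
  imports "HOL-Analysis.Analysis"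
begin

unbundle cardinal_syntax

section \<open>Spaces and maps\<close>

definition tychonoff_space :: "'a topology \<Rightarrow> bool" where
  "tychonoff_space X \<longleftrightarrow> completely_regular_space X \<and> Hausdorff_space X"

definition compactum :: "'a topology \<Rightarrow> bool" where
  "compactum X \<longleftrightarrow> compact_space X \<and> Hausdorff_space X"

definition map_onto :: "'a topology \<Rightarrow> 'b topology \<Rightarrow> ('a \<Rightarrow> 'b) \<Rightarrow> bool" where
  "map_onto X Z f \<longleftrightarrow>
     tychonoff_space Z \<and> continuous_map X Z f \<and> f ` topspace X = topspace Z"

text \<open>The order and the identification of maps \<open>f1 : X \<rightarrow> Z1\<close>, \<open>f2 : X \<rightarrow> Z2\<close>;
  only the images of \<open>f1\<close> and \<open>f2\<close> matter.\<close>

definition map_prec ::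
  "'a topology \<Rightarrow> 'b topology \<Rightarrow> ('a \<Rightarrow> 'b) \<Rightarrow> 'c topology \<Rightarrow> ('a \<Rightarrow> 'c) \<Rightarrow> bool" where
  "map_prec X Z1 f1 Z2 f2 \<longleftrightarrow>
     (\<exists>g. continuous_map (subtopology Z1 (f1 ` topspace X)) (subtopology Z2 (f2 ` topspace X)) g \<and>
          (\<forall>x\<in>topspace X. f2 x = g (f1 x)))"

definition map_equiv ::
  "'a topology \<Rightarrow> 'b topology \<Rightarrow> ('a \<Rightarrow> 'b) \<Rightarrow> 'c topology \<Rightarrow> ('a \<Rightarrow> 'c) \<Rightarrow> bool" where
  "map_equiv X Z1 f1 Z2 f2 \<longleftrightarrow>
     (\<exists>g. homeomorphic_map (subtopology Z1 (f1 ` topspace X)) (subtopology Z2 (f2 ` topspace X)) g \<and>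
          (\<forall>x\<in>topspace X. f2 x = g (f1 x)))"

definition skeletal_map :: "'a topology \<Rightarrow> 'b topology \<Rightarrow> ('a \<Rightarrow> 'b) \<Rightarrow> bool" where
  "skeletal_map X Y f \<longleftrightarrow> continuous_map X Y f \<and>
     (\<forall>U. openin X U \<and> U \<noteq> {} \<longrightarrow> Y interior_of (Y closure_of (f ` U)) \<noteq> {})"


section \<open>Absolutes\<close>

definition extremally_disconnected :: "'a topology \<Rightarrow> bool" where
  "extremally_disconnected X \<longleftrightarrow> (\<forall>U. openin X U \<longrightarrow> openin X (X closure_of U))"

definition irreducible_map :: "'a topology \<Rightarrow> 'b topology \<Rightarrow> ('a \<Rightarrow> 'b) \<Rightarrow> bool" where
  "irreducible_map X Y f \<longleftrightarrow>
     continuous_map X Y f \<and> f ` topspace X = topspace Y \<and>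
     (\<forall>C. closedin X C \<and> f ` C = topspace Y \<longrightarrow> C = topspace X)"

definition is_absolute_of :: "'e topology \<Rightarrow> 'a topology \<Rightarrow> bool" where
  "is_absolute_of E X \<longleftrightarrow>
     tychonoff_space E \<and> extremally_disconnected E \<and>
     (\<exists>f. perfect_map E X f \<and> irreducible_map E X f)"


section \<open>Weight and \<open>\<kappa>\<close>-metrizable compacta\<close>

definition base_of :: "'a topology \<Rightarrow> 'a set set \<Rightarrow> bool" where
  "base_of X \<B> \<longleftrightarrow>
     (\<forall>V\<in>\<B>. openin X V) \<and> (\<forall>U x. openin X U \<and> x \<in> U \<longrightarrow> (\<exists>V\<in>\<B>. x \<in> V \<and> V \<subseteq> U))"

text \<open>The summand \<^typ>\<open>nat\<close> makes infinite cardinals available when \<open>'a\<close> is finite; the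
  cardinals on \<open>'a set + nat\<close> include all those that can occur as the weight.\<close>

definition is_weight :: "'a topology \<Rightarrow> ('a set + nat) rel \<Rightarrow> bool" where
  "is_weight X \<kappa> \<longleftrightarrow>
     Cinfinite \<kappa> \<and> (\<exists>\<B>. base_of X \<B> \<and> |\<B>| \<le>o \<kappa>) \<and>
     (\<forall>\<kappa>' :: ('a set + nat) rel.
        Cinfinite \<kappa>' \<and> (\<exists>\<B>. base_of X \<B> \<and> |\<B>| \<le>o \<kappa>') \<longrightarrow> \<kappa> \<le>o \<kappa>')"

definition weight :: "'a topology \<Rightarrow> ('a set + nat) rel" where
  "weight X = (SOME \<kappa>. is_weight X \<kappa>)"

text \<open>A family of maps on \<open>X\<close> is a set of pairs \<open>(Z, \<phi>)\<close> with \<open>\<phi>\<close> a map of \<open>X\<close> onto \<open>Z\<close>.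
  An image of \<open>X\<close> has at most as many points as \<open>X\<close>, so up to \<open>map_equiv\<close> every map with
  domain \<open>X\<close> has an image whose points lie in \<open>'a\<close>. Membership of diagonal products in the
  family is understood up to \<open>map_equiv\<close>.\<close>

definition diagonal_in ::
  "'a topology \<Rightarrow> ('a topology \<times> ('a \<Rightarrow> 'a)) set \<Rightarrow> ('a topology \<times> ('a \<Rightarrow> 'a)) set \<Rightarrow> bool" where
  "diagonal_in X \<F> \<Psi> \<longleftrightarrow>
     (\<exists>(Z, \<psi>)\<in>\<Psi>. map_equiv X (product_topology fst \<F>) (\<lambda>x. \<lambda>m\<in>\<F>. snd m x) Z \<psi>)"

definition lattice_of_open_maps ::
  "'a topology \<Rightarrow> ('a topology \<times> ('a \<Rightarrow> 'a)) set \<Rightarrow> bool" where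
  "lattice_of_open_maps X \<Psi> \<longleftrightarrow>
     (\<forall>(Z, \<phi>)\<in>\<Psi>. map_onto X Z \<phi> \<and> open_map X Z \<phi>) \<and>
     (\<forall>(Z :: 'a topology) f. map_onto X Z f \<longrightarrow>
        (\<exists>(W, \<phi>)\<in>\<Psi>. map_prec X W \<phi> Z f \<and> weight W \<le>o weight Z)) \<and>
     (\<forall>\<F>. \<F> \<subseteq> \<Psi> \<and> \<F> \<noteq> {} \<and>
        (\<forall>\<G>. \<G> \<subseteq> \<F> \<and> finite \<G> \<and> \<G> \<noteq> {} \<longrightarrow> diagonal_in X \<G> \<Psi>) \<longrightarrow> diagonal_in X \<F> \<Psi>)"

definition kappa_metrizable_compactum :: "'a topology \<Rightarrow> bool" where
  "kappa_metrizable_compactum X \<longleftrightarrow> compactum X \<and> (\<exists>\<Psi>. lattice_of_open_maps X \<Psi>)"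


section \<open>Inverse systems and skeletally generated spaces\<close>

text \<open>An index set \<open>A\<close> is ordered by a relation \<open>r\<close>, and \<open>p \<alpha> \<beta>\<close> is the bonding map from the
  \<open>\<beta>\<close>-th to the \<open>\<alpha>\<close>-th space, for \<open>(\<alpha>, \<beta>) \<in> r\<close>.\<close>

definition directed_order :: "'i set \<Rightarrow> 'i rel \<Rightarrow> bool" where
  "directed_order A r \<longleftrightarrow> partial_order_on A r \<and> A \<noteq> {} \<and>
     (\<forall>\<alpha>\<in>A. \<forall>\<beta>\<in>A. \<exists>\<gamma>\<in>A. (\<alpha>, \<gamma>) \<in> r \<and> (\<beta>, \<gamma>) \<in> r)"

definition is_sup :: "'i set \<Rightarrow> 'i rel \<Rightarrow> 'i set \<Rightarrow> 'i \<Rightarrow> bool" where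
  "is_sup A r C \<beta> \<longleftrightarrow> \<beta> \<in> A \<and> (\<forall>\<alpha>\<in>C. (\<alpha>, \<beta>) \<in> r) \<and>
     (\<forall>\<gamma>\<in>A. (\<forall>\<alpha>\<in>C. (\<alpha>, \<gamma>) \<in> r) \<longrightarrow> (\<beta>, \<gamma>) \<in> r)"

definition sigma_complete :: "'i set \<Rightarrow> 'i rel \<Rightarrow> bool" where
  "sigma_complete A r \<longleftrightarrow>
     (\<forall>C. C \<subseteq> A \<and> C \<in> Chains r \<and> countable C \<and> C \<noteq> {} \<longrightarrow> (\<exists>\<beta>. is_sup A r C \<beta>))"

definition inverse_system ::
  "'i set \<Rightarrow> 'i rel \<Rightarrow> ('i \<Rightarrow> 'p topology) \<Rightarrow> ('i \<Rightarrow> 'i \<Rightarrow> 'p \<Rightarrow> 'p) \<Rightarrow> bool" where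
  "inverse_system A r X p \<longleftrightarrow> directed_order A r \<and>
     (\<forall>\<alpha> \<beta>. (\<alpha>, \<beta>) \<in> r \<longrightarrow> continuous_map (X \<beta>) (X \<alpha>) (p \<alpha> \<beta>)) \<and>
     (\<forall>\<alpha>\<in>A. \<forall>x\<in>topspace (X \<alpha>). p \<alpha> \<alpha> x = x) \<and>
     (\<forall>\<alpha> \<beta> \<gamma>. (\<alpha>, \<beta>) \<in> r \<and> (\<beta>, \<gamma>) \<in> r \<longrightarrow>
        (\<forall>x\<in>topspace (X \<gamma>). p \<alpha> \<gamma> x = p \<alpha> \<beta> (p \<beta> \<gamma> x)))"

definition inverse_limit ::
  "'i set \<Rightarrow> 'i rel \<Rightarrow> ('i \<Rightarrow> 'p topology) \<Rightarrow> ('i \<Rightarrow> 'i \<Rightarrow> 'p \<Rightarrow> 'p) \<Rightarrow> ('i \<Rightarrow> 'p) topology" where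
  "inverse_limit A r X p =
     subtopology (product_topology X A) {x. \<forall>\<alpha> \<beta>. (\<alpha>, \<beta>) \<in> r \<longrightarrow> p \<alpha> \<beta> (x \<beta>) = x \<alpha>}"

abbreviation sequence_limit ::
  "(nat \<Rightarrow> 'i) \<Rightarrow> ('i \<Rightarrow> 'p topology) \<Rightarrow> ('i \<Rightarrow> 'i \<Rightarrow> 'p \<Rightarrow> 'p) \<Rightarrow> (nat \<Rightarrow> 'p) topology" where
  "sequence_limit s X p \<equiv>
     inverse_limit UNIV {(m, n). m \<le> n} (\<lambda>n. X (s n)) (\<lambda>m n. p (s m) (s n))"

text \<open>\<open>e\<close> is the embedding of \<open>Y\<close> into the limit, so that \<open>\<lambda>y. e y \<alpha>\<close> is the restriction to
  \<open>Y\<close> of the \<open>\<alpha>\<close>-th limit projection. Likewise \<open>X \<beta>\<close> is a subset of the limit of a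
  sequence with supremum \<open>\<beta>\<close> by way of the map induced by the bonding maps.\<close>

definition skeletally_generated_by ::
  "'b topology \<Rightarrow> 'i set \<Rightarrow> 'i rel \<Rightarrow> ('i \<Rightarrow> 'p topology) \<Rightarrow> ('i \<Rightarrow> 'i \<Rightarrow> 'p \<Rightarrow> 'p) \<Rightarrow> bool" where
  "skeletally_generated_by Y A r X p \<longleftrightarrow>
     inverse_system A r X p \<and>
     (\<forall>\<alpha>\<in>A. metrizable_space (X \<alpha>) \<and> separable_space (X \<alpha>)) \<and>
     (\<forall>\<alpha> \<beta>. (\<alpha>, \<beta>) \<in> r \<longrightarrow>
        p \<alpha> \<beta> ` topspace (X \<beta>) = topspace (X \<alpha>) \<and> skeletal_map (X \<beta>) (X \<alpha>) (p \<alpha> \<beta>)) \<and>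
     sigma_complete A r \<and>
     (\<forall>s \<beta>. range s \<subseteq> A \<and> (\<forall>n. (s n, s (Suc n)) \<in> r) \<and> is_sup A r (range s) \<beta> \<longrightarrow>
        embedding_map (X \<beta>) (sequence_limit s X p) (\<lambda>x n. p (s n) \<beta> x) \<and>
        sequence_limit s X p closure_of ((\<lambda>x n. p (s n) \<beta> x) ` topspace (X \<beta>))
          = topspace (sequence_limit s X p)) \<and>
     (\<exists>e. embedding_map Y (inverse_limit A r X p) e \<and>
          (\<forall>\<alpha>\<in>A. (\<lambda>y. e y \<alpha>) ` topspace Y = topspace (X \<alpha>)) \<and>
          (\<forall>f. continuous_map Y euclideanreal f \<and> bounded (f ` topspace Y) \<longrightarrow>
             (\<exists>\<alpha>\<in>A. map_prec Y (X \<alpha>) (\<lambda>y. e y \<alpha>) euclideanreal f)))"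

text \<open>The existential quantifier needs fixed types, and the ones chosen lose nothing. A separable
  metrizable space has at most continuum many points, hence a copy on a subset of
  \<open>nat \<Rightarrow> real\<close>. Given any system as above, pick an index for every bounded continuous
  function on \<open>Y\<close> and close the set of these under upper bounds of pairs and suprema of
  countable chains: the restricted system still generates \<open>Y\<close>, and its index set is no larger
  than \<open>'b \<Rightarrow> real\<close>.\<close>

definition skeletally_generated :: "'b topology \<Rightarrow> bool" where
  "skeletally_generated Y \<longleftrightarrow>
     (\<exists>(A :: ('b \<Rightarrow> real) set set) r (X :: ('b \<Rightarrow> real) set \<Rightarrow> (nat \<Rightarrow> real) topology) p.
        skeletally_generated_by Y A r X p)"

end

(* Composing with the homeomorphism of the absolutes yields one compact space E with closed
   irreducible maps f : E -> X and g : E -> Y, so Y is compact and every non-empty open subset of E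
   contains sets of the form f^-1(U) and g^-1(V) with U and V open and non-empty.

   For a countable set alpha of continuous functions on Y let q be its diagonal map. If the
   preimages in E of the open sets of q(Y), and those of the open sets of phi(X) for some open map
   phi on X, refine each other, then openness of phi passes to skeletality of q. To obtain a
   sigma-complete family of such sets alpha, open maps phi of countable weight are chosen along all
   finite lists of functions on Y, in such a way that the map of a list refines those of its tails and
   sees the cylinders of the list; a countable set alpha closed under the functions that witness the
   refinement in the other direction is then skeletal, because enumerating alpha gives a decreasing
   sequence of open maps whose diagonal product is open by the lattice property. Being closed in
   this sense is preserved by unions of chains, and every countable set has a countable closed
   superset. *)

theory Submission
  imports Defs
begin

section \<open>Countability and weight\<close>

lemma second_countable_iff_base_of:
  "second_countable X \<longleftrightarrow> (\<exists>\<B>. countable \<B> \<and> base_of X \<B>)"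
  by (auto simp: second_countable_def base_of_def)

lemma compactum_imp_tychonoff: "compactum X \<Longrightarrow> tychonoff_space X"
  by (simp add: compactum_def tychonoff_space_def compact_Hausdorff_or_regular_imp_normal_space
      normal_imp_completely_regular_space)

lemma countable_iff_ordLeq_natLeq: "countable A \<longleftrightarrow> |A| \<le>o natLeq"
proof -
  have "countable A \<longleftrightarrow> |A| \<le>o |UNIV :: nat set|"
    unfolding countable_def card_of_ordLeq[symmetric] by simp
  then show ?thesis
    using card_of_nat ordIso_symmetric ordLeq_ordIso_trans by blast
qed

text \<open>Cardinals are well-ordered, so a least admissible one exists as soon as there is any.
  All open sets together form a base, and \<open>Inl\<close> bounds their number by the cardinal of
  the whole type. Hence the choice made in \<open>weight\<close> is a genuine weight.\<close>

lemma is_weight_weight: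
  fixes X :: "'a topology"
  shows "is_weight X (weight X)"
proof -
  let ?R = "{\<kappa> :: ('a set + nat) rel. Cinfinite \<kappa> \<and> (\<exists>\<B>. base_of X \<B> \<and> |\<B>| \<le>o \<kappa>)}"
  have "|{U. openin X U}| \<le>o |UNIV :: ('a set + nat) set|"
    by (rule card_of_ordLeqI[where f = Inl]) auto
  moreover have "base_of X {U. openin X U}"
    by (auto simp: base_of_def)
  moreover have "Cinfinite |UNIV :: ('a set + nat) set|"
    by (auto simp: cinfinite_def card_of_card_order_on Field_card_of)
  ultimately have "|UNIV| \<in> ?R"
    by blast
  then have "\<exists>\<kappa>\<in>?R. \<forall>\<kappa>'\<in>?R. \<kappa> \<le>o \<kappa>'"
    by (intro exists_minim_Card_order) auto
  then have "\<exists>\<kappa>. is_weight X \<kappa>"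
    unfolding is_weight_def by blast
  then show ?thesis
    unfolding weight_def by (rule someI_ex)
qed

lemma weight_ordLeq_natLeq:
  fixes X :: "'a topology"
  assumes "second_countable X"
  shows "weight X \<le>o natLeq"
proof -
  \<comment> \<open>\<open>is_weight\<close> compares only cardinals on \<open>'a set + nat\<close>,
    whereas \<open>natLeq\<close> lives on \<open>nat\<close>; this is a copy of it on the right
    type.\<close>
  let ?\<kappa> = "|range (Inr :: nat \<Rightarrow> 'a set + nat)|"
  obtain \<B> where "countable \<B>" "base_of X \<B>"
    using assms second_countable_iff_base_of by blast
  have "|UNIV :: nat set| =o ?\<kappa>"
    by (rule card_of_ordIsoI[where f = Inr]) (simp add: bij_betw_def)
  then have iso: "?\<kappa> =o natLeq"
    using card_of_nat ordIso_symmetric ordIso_transitive by blast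
  moreover have "|\<B>| \<le>o natLeq"
    using \<open>countable \<B>\<close> by (simp add: countable_iff_ordLeq_natLeq)
  ultimately have "|\<B>| \<le>o ?\<kappa>"
    using ordIso_symmetric ordLeq_ordIso_trans by blast
  moreover have "Cinfinite ?\<kappa>"
    by (auto simp: cinfinite_def range_inj_infinite card_of_card_order_on Field_card_of)
  ultimately have "weight X \<le>o ?\<kappa>"
    using is_weight_weight[of X] \<open>base_of X \<B>\<close> unfolding is_weight_def by blast
  then show ?thesis
    using iso ordLeq_ordIso_trans by blast
qed

text \<open>The lattice property compares weights as cardinals. This translates the comparison into
  second countability, the form in which smallness is tracked from here on.\<close>

lemma second_countable_weight_mono:
  assumes "weight W \<le>o weight Z" "second_countable Z"
  shows "second_countable W"
proof -
  obtain \<B> where \<B>: "base_of W \<B>" "|\<B>| \<le>o weight W"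
    using is_weight_weight[of W] unfolding is_weight_def by (elim conjE exE)
  then have "|\<B>| \<le>o natLeq"
    using weight_ordLeq_natLeq[OF assms(2)] assms(1) by (meson ordLeq_transitive)
  then have "countable \<B>"
    by (simp add: countable_iff_ordLeq_natLeq)
  then show ?thesis
    using \<B> second_countable_iff_base_of by blast
qed

section \<open>Second countability of products, Euclidean spaces and pullbacks\<close>

lemma second_countable_prod_topology:
  assumes "second_countable X" "second_countable Y"
  shows "second_countable (prod_topology X Y)"
proof -
  obtain \<A> \<B> where AB: "countable \<A>" "base_of X \<A>" "countable \<B>" "base_of Y \<B>"
    using assms second_countable_iff_base_of by metis
  let ?P = "(\<lambda>(U, V). U \<times> V) ` (\<A> \<times> \<B>)"
  have "base_of (prod_topology X Y) ?P"
    unfolding base_of_def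
  proof (intro conjI allI impI ballI)
    fix W assume "W \<in> ?P"
    then show "openin (prod_topology X Y) W"
      using AB by (auto simp: base_of_def openin_prod_Times_iff)
  next
    fix W z assume "openin (prod_topology X Y) W \<and> z \<in> W"
    then obtain U V where "openin X U" "openin Y V" "z \<in> U \<times> V" "U \<times> V \<subseteq> W"
      unfolding openin_prod_topology_alt by (metis mem_Sigma_iff surj_pair)
    then obtain U' V' where "U' \<in> \<A>" "V' \<in> \<B>" "z \<in> U' \<times> V'" "U' \<subseteq> U" "V' \<subseteq> V"
      using AB unfolding base_of_def by (metis mem_Times_iff)
    then show "\<exists>O'\<in>?P. z \<in> O' \<and> O' \<subseteq> W"
      using \<open>U \<times> V \<subseteq> W\<close> by (intro bexI[of _ "U' \<times> V'"]) auto
  qed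
  then show ?thesis
    using AB second_countable_iff_base_of by (metis countable_SIGMA countable_image)
qed

lemma second_countable_euclidean:
  "second_countable (euclidean :: 'a::second_countable_topology topology)"
proof -
  obtain B :: "'a set set" where "countable B" "topological_basis B"
    using ex_countable_basis by blast
  then have "base_of euclidean B"
    unfolding base_of_def open_openin[symmetric]
    by (meson topological_basis_open topological_basisE)
  then show ?thesis
    using \<open>countable B\<close> second_countable_iff_base_of by blast
qed

lemma continuous_map_coordinate:
  "continuous_map euclidean euclideanreal (\<lambda>z :: nat \<Rightarrow> real. z n)"
  unfolding euclidean_product_topology[symmetric] by (rule continuous_map_product_projection) simp

lemma second_countable_pullback_topology:
  assumes "second_countable K"
  shows "second_countable (pullback_topology A k K)"
proof -
  obtain \<B> where \<B>: "countable \<B>" "base_of K \<B>"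
    using assms second_countable_iff_base_of by metis
  have "base_of (pullback_topology A k K) ((\<lambda>V. k -` V \<inter> A) ` \<B>)"
    unfolding base_of_def
  proof (intro conjI allI impI ballI)
    fix W assume "W \<in> (\<lambda>V. k -` V \<inter> A) ` \<B>"
    then show "openin (pullback_topology A k K) W"
      using \<B>(2) by (auto simp: base_of_def openin_pullback_topology)
  next
    fix W z assume "openin (pullback_topology A k K) W \<and> z \<in> W"
    then obtain U where U: "openin K U" "W = k -` U \<inter> A" "k z \<in> U" "z \<in> A"
      by (auto simp: openin_pullback_topology)
    then obtain V where "V \<in> \<B>" "k z \<in> V" "V \<subseteq> U"
      using \<B>(2) unfolding base_of_def by blast
    then show "\<exists>O'\<in>(\<lambda>V. k -` V \<inter> A) ` \<B>. z \<in> O' \<and> O' \<subseteq> W"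
      using U by auto
  qed
  then show ?thesis
    using \<B>(1) second_countable_iff_base_of by (metis countable_image)
qed

section \<open>Lattices of open maps\<close>

text \<open>The image of \<open>X\<close> under \<open>k\<close> is realised on a set of representatives of the fibres,
  since the lattice property only speaks about images whose points have type \<^typ>\<open>'a\<close>.\<close>

lemma lattice_open_maps_factor:
  fixes X :: "'a topology"
  assumes "compactum X" "lattice_of_open_maps X \<Psi>"
    and "continuous_map X K k" "Hausdorff_space K" "second_countable K"
  obtains W \<phi> where "(W, \<phi>) \<in> \<Psi>" "second_countable W" "map_prec X W \<phi> K k"
proof -
  define f where "f = (\<lambda>x. inv_into (topspace X) k (k x))"
  define Z where "Z = pullback_topology (f ` topspace X) k K"
  have kX: "k x \<in> topspace K" if "x \<in> topspace X" for x
    using assms(3) that by (simp add: continuous_map_def Pi_iff)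
  have fX: "f x \<in> topspace X" "k (f x) = k x" if "x \<in> topspace X" for x
    using that by (auto simp: f_def inv_into_into f_inv_into_f)
  have topZ: "topspace Z = f ` topspace X"
    using fX kX by (auto simp: Z_def topspace_pullback_topology)
  have "continuous_map X K (k \<circ> f)"
    using assms(3) fX by (auto intro: continuous_map_eq)
  then have cf: "continuous_map X Z f"
    unfolding Z_def by (intro continuous_map_pullback') auto
  have ck: "continuous_map Z K k"
    using continuous_map_pullback[OF continuous_map_id, of _ k K] by (simp add: Z_def)
  \<comment> \<open>Each fibre of \<open>k\<close> has one representative, so \<open>k\<close> is
    injective on \<open>Z\<close> and the Hausdorff property of \<open>K\<close> pulls back. Being
    also a compact image of \<open>X\<close>, \<open>Z\<close> is an admissible target for the
    lattice property.\<close>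
  have "inj_on k (topspace Z)"
    unfolding topZ by (auto simp: inj_on_def f_def f_inv_into_f)
  then have "Hausdorff_space Z"
    using Hausdorff_space_injective_preimage[OF assms(4) ck] by blast
  moreover have "compact_space Z"
    using image_compactin[OF _ cf, of "topspace X"] assms(1) topZ
    by (simp add: compactum_def compact_space_def)
  ultimately have "map_onto X Z f"
    using cf topZ compactum_imp_tychonoff by (auto simp: map_onto_def compactum_def)
  then obtain W \<phi> where W: "(W, \<phi>) \<in> \<Psi>" "map_prec X W \<phi> Z f" "weight W \<le>o weight Z"
    using assms(2) unfolding lattice_of_open_maps_def by blast
  moreover have "second_countable W"
    by (rule second_countable_weight_mono[OF W(3)[unfolded Z_def]
          second_countable_pullback_topology[OF assms(5)]])
  moreover have "map_prec X W \<phi> K k"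
  proof -
    obtain g where g: "continuous_map (subtopology W (\<phi> ` topspace X)) (subtopology Z (f ` topspace X)) g"
      "\<And>x. x \<in> topspace X \<Longrightarrow> f x = g (\<phi> x)"
      using W(2) unfolding map_prec_def by blast
    have "continuous_map (subtopology Z (f ` topspace X)) (subtopology K (k ` topspace X)) k"
      using ck fX by (auto simp: continuous_map_in_subtopology continuous_map_from_subtopology)
    then have "continuous_map (subtopology W (\<phi> ` topspace X)) (subtopology K (k ` topspace X)) (k \<circ> g)"
      using continuous_map_compose[OF g(1)] by blast
    then show ?thesis
      unfolding map_prec_def using g(2) fX(2) by (intro exI[of _ "k \<circ> g"]) auto
  qed
  ultimately show thesis
    using that by blast
qed

lemma lattice_open_maps_member:
  assumes "lattice_of_open_maps X \<Psi>" "(W, \<phi>) \<in> \<Psi>"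
  shows "continuous_map X W \<phi>" "\<phi> ` topspace X = topspace W" "Hausdorff_space W"
    "open_map X W \<phi>"
proof -
  have "\<forall>(Z, \<phi>)\<in>\<Psi>. map_onto X Z \<phi> \<and> open_map X Z \<phi>"
    using assms(1) unfolding lattice_of_open_maps_def by (rule conjunct1)
  then have "map_onto X W \<phi> \<and> open_map X W \<phi>"
    using assms(2) by blast
  then show "continuous_map X W \<phi>" "\<phi> ` topspace X = topspace W" "Hausdorff_space W"
    "open_map X W \<phi>"
    by (simp_all add: map_onto_def tychonoff_space_def)
qed

section \<open>The order of maps and diagonals of decreasing sequences\<close>

lemma map_prec_trans:
  assumes "map_prec X Z1 f1 Z2 f2" "map_prec X Z2 f2 Z3 f3"
  shows "map_prec X Z1 f1 Z3 f3"
proof -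
  obtain g h where g: "continuous_map (subtopology Z1 (f1 ` topspace X)) (subtopology Z2 (f2 ` topspace X)) g"
      "\<And>x. x \<in> topspace X \<Longrightarrow> f2 x = g (f1 x)"
    and h: "continuous_map (subtopology Z2 (f2 ` topspace X)) (subtopology Z3 (f3 ` topspace X)) h"
      "\<And>x. x \<in> topspace X \<Longrightarrow> f3 x = h (f2 x)"
    using assms unfolding map_prec_def by blast
  show ?thesis
    unfolding map_prec_def
    using continuous_map_compose[OF g(1) h(1)] g(2) h(2) by (intro exI[of _ "h \<circ> g"]) simp
qed

text \<open>Pull \<open>G\<close> back along the factor map. Conditions imposed on several maps of a
  decreasing sequence can thus be expressed through the finest of them.\<close>

lemma map_prec_open_preimage:
  assumes "map_prec X Z1 f1 Z2 f2" "f1 ` topspace X = topspace Z1" "openin Z2 G"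
  obtains G' where "openin Z1 G'" "{x \<in> topspace X. f1 x \<in> G'} = {x \<in> topspace X. f2 x \<in> G}"
proof -
  obtain g where g: "continuous_map Z1 (subtopology Z2 (f2 ` topspace X)) g"
    "\<And>x. x \<in> topspace X \<Longrightarrow> f2 x = g (f1 x)"
    using assms(1) unfolding map_prec_def assms(2) subtopology_topspace by blast
  have "continuous_map Z1 Z2 g"
    using g(1) continuous_map_in_subtopology by blast
  then have "openin Z1 {z \<in> topspace Z1. g z \<in> G}"
    using assms(3) openin_continuous_map_preimage by blast
  moreover have "{x \<in> topspace X. f1 x \<in> {z \<in> topspace Z1. g z \<in> G}} = {x \<in> topspace X. f2 x \<in> G}"
    using g(2) assms(2) by auto
  ultimately show thesis
    using that by blast
qed

text \<open>The coordinate of the finest member determines all others, so projecting to it is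
  injective on the image of the diagonal. That image is compact and \<open>W\<close> is Hausdorff,
  so the projection is a homeomorphism.\<close>

lemma map_equiv_diagonal:
  assumes "compactum X" "continuous_map X W \<phi>" "\<phi> ` topspace X = topspace W" "Hausdorff_space W"
    and "(W, \<phi>) \<in> \<G>"
    and "\<And>m. m \<in> \<G> \<Longrightarrow> continuous_map X (fst m) (snd m)"
    and "\<And>m. m \<in> \<G> \<Longrightarrow> map_prec X W \<phi> (fst m) (snd m)"
  shows "map_equiv X (product_topology fst \<G>) (\<lambda>x. \<lambda>m\<in>\<G>. snd m x) W \<phi>"
proof -
  let ?d = "\<lambda>x. \<lambda>m\<in>\<G>. snd m x" and ?P = "product_topology fst \<G>"
  let ?S = "subtopology ?P (?d ` topspace X)"
  let ?g = "\<lambda>z. z (W, \<phi>)"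
  have d: "continuous_map X ?P ?d"
    using assms(6) by (simp add: continuous_map_componentwise image_subset_iff)
  have top: "topspace ?S = ?d ` topspace X"
    using continuous_map_image_subset_topspace[OF d] by auto
  have c: "continuous_map ?S W ?g"
    using continuous_map_product_projection[OF assms(5), of fst]
    by (auto intro: continuous_map_from_subtopology)
  have "compactin ?P (?d ` topspace X)"
    using d assms(1) by (auto simp: compactum_def compact_space_def intro: image_compactin)
  then have "compact_space ?S"
    by (simp add: compact_space_subtopology)
  moreover have "inj_on ?g (topspace ?S)"
    unfolding top
  proof (clarsimp simp: inj_on_def assms(5))
    fix x y assume xy: "x \<in> topspace X" "y \<in> topspace X" "\<phi> x = \<phi> y"
    have "snd m x = snd m y" if "m \<in> \<G>" for m
      using assms(7)[OF that] xy unfolding map_prec_def by metis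
    then show "?d x = ?d y"
      by (auto simp: restrict_def fun_eq_iff)
  qed
  moreover have "?g ` topspace ?S = topspace W"
    unfolding top using assms(3,5) by (auto simp: image_image)
  ultimately have "homeomorphic_map ?S W ?g"
    using c assms(4) continuous_imp_homeomorphic_map by blast
  then show ?thesis
    unfolding map_equiv_def using assms(3,5) by auto
qed

text \<open>Closure of the lattice under diagonals makes the diagonal of the whole sequence open
  onto its image, so the image of \<open>U\<close> contains a relatively open basic set. Such a set
  restricts finitely many coordinates and is therefore described by a single \<open>m n\<close>. A
  point over it shares its whole diagonal with some point of \<open>U\<close>, which serves every
  \<open>k\<close> at once.\<close>

lemma lattice_open_maps_sequence:
  fixes X :: "'a topology" and m :: "nat \<Rightarrow> 'a topology \<times> ('a \<Rightarrow> 'a)"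
  assumes "compactum X" and lat: "lattice_of_open_maps X \<Psi>"
    and m: "\<And>n. m n \<in> \<Psi>"
    and dec: "\<And>n. map_prec X (fst (m (Suc n))) (snd (m (Suc n))) (fst (m n)) (snd (m n))"
    and U: "openin X U" "U \<noteq> {}"
  obtains n G where "openin (fst (m n)) G" "{x \<in> topspace X. snd (m n) x \<in> G} \<noteq> {}"
    "\<And>x k. x \<in> topspace X \<Longrightarrow> snd (m n) x \<in> G \<Longrightarrow> \<exists>u\<in>U. snd (m k) u = snd (m k) x"
proof -
  have "(fst (m n), snd (m n)) \<in> \<Psi>" for n
    using m by simp
  note onto = lattice_open_maps_member[OF lat this]
  have cont: "continuous_map X (fst (m n)) (snd (m n))"
    and surj: "snd (m n) ` topspace X = topspace (fst (m n))"
    and haus: "Hausdorff_space (fst (m n))" for n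
    by (fact onto)+
  have prec: "map_prec X (fst (m l)) (snd (m l)) (fst (m n)) (snd (m n))" if "n \<le> l" for n l
    using that
  proof (induction l rule: dec_induct)
    case base
    show ?case
      unfolding map_prec_def by (rule exI[of _ id]) auto
  next
    case (step l)
    then show ?case using dec map_prec_trans by blast
  qed
  define \<F> where "\<F> = range m"
  \<comment> \<open>A finite part of the sequence has a member of largest index, and its diagonal is
    equivalent to that member.\<close>
  have "diagonal_in X \<G> \<Psi>" if fin: "\<G> \<subseteq> \<F>" "finite \<G>" "\<G> \<noteq> {}" for \<G>
  proof -
    obtain N where N: "finite N" "\<G> = m ` N"
      using finite_subset_image[OF fin(2), of m UNIV] fin(1) \<F>_def by blast
    let ?l = "Max N"
    have l: "?l \<in> N" "\<And>n. n \<in> N \<Longrightarrow> n \<le> ?l"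
      using N fin(3) by auto
    have "map_equiv X (product_topology fst \<G>) (\<lambda>x. \<lambda>m\<in>\<G>. snd m x) (fst (m ?l)) (snd (m ?l))"
    proof (rule map_equiv_diagonal[OF assms(1) cont surj haus])
      show "(fst (m ?l), snd (m ?l)) \<in> \<G>"
        using l(1) N(2) by simp
      fix i assume "i \<in> \<G>"
      then obtain n where n: "n \<in> N" "i = m n"
        using N(2) by blast
      show "continuous_map X (fst i) (snd i)"
        unfolding n(2) by (rule cont)
      show "map_prec X (fst (m ?l)) (snd (m ?l)) (fst i) (snd i)"
        unfolding n(2) by (rule prec[OF l(2)[OF n(1)]])
    qed
    then show ?thesis
      unfolding diagonal_in_def using m[of ?l] by (metis (no_types, lifting) case_prodI prod.collapse)
  qed
  moreover have "\<F> \<subseteq> \<Psi>" "\<F> \<noteq> {}"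
    using m by (auto simp: \<F>_def)
  ultimately have "diagonal_in X \<F> \<Psi>"
    using lat unfolding lattice_of_open_maps_def by blast
  then obtain Z \<psi> where Z: "(Z, \<psi>) \<in> \<Psi>"
    and eq: "map_equiv X (product_topology fst \<F>) (\<lambda>x. \<lambda>m\<in>\<F>. snd m x) Z \<psi>"
    unfolding diagonal_in_def by blast
  let ?d = "\<lambda>x. \<lambda>m\<in>\<F>. snd m x" and ?P = "product_topology fst \<F>"
  let ?S = "subtopology ?P (?d ` topspace X)"
  have \<psi>: "\<psi> ` topspace X = topspace Z" "open_map X Z \<psi>"
    using lattice_open_maps_member[OF lat Z] by auto
  obtain h where h: "homeomorphic_map ?S Z h" "\<And>x. x \<in> topspace X \<Longrightarrow> \<psi> x = h (?d x)"
    using eq \<psi> unfolding map_equiv_def by auto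
  have d: "continuous_map X ?P ?d"
    using cont by (auto simp: continuous_map_componentwise image_subset_iff \<F>_def)
  have top: "topspace ?S = ?d ` topspace X"
    using continuous_map_image_subset_topspace[OF d] by auto
  have "openin Z (\<psi> ` U)"
    using \<psi> U by (auto simp: open_map_def)
  then have "openin ?S {z \<in> topspace ?S. h z \<in> \<psi> ` U}"
    using h(1) homeomorphic_imp_continuous_map openin_continuous_map_preimage by blast
  then obtain O' where O': "openin ?P O'" "{z \<in> topspace ?S. h z \<in> \<psi> ` U} = O' \<inter> ?d ` topspace X"
    unfolding openin_subtopology by blast
  have UX: "U \<subseteq> topspace X"
    using U openin_subset by blast
  obtain x where x: "x \<in> U"
    using U by blast
  have "?d x \<in> topspace ?S"
    unfolding top using x UX by (intro imageI) blast
  moreover have "h (?d x) = \<psi> x"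
    using h(2)[of x] x UX by auto
  ultimately have "?d x \<in> {z \<in> topspace ?S. h z \<in> \<psi> ` U}"
    using x by simp
  then have "?d x \<in> O'"
    using O'(2) by blast
  from product_topology_open_contains_basis[OF O'(1) this]
  obtain V where V: "?d x \<in> Pi\<^sub>E \<F> V" "\<forall>i. openin (fst i) (V i)"
    "finite {i. V i \<noteq> topspace (fst i)}" "Pi\<^sub>E \<F> V \<subseteq> O'"
    by (elim exE conjE)
  \<comment> \<open>\<open>N\<close> is a finite set of indices naming all factors that the basic
    set really constrains.\<close>
  obtain N where N: "finite N" "{i \<in> \<F>. V i \<noteq> topspace (fst i)} = m ` N"
    using finite_subset_image[of "{i \<in> \<F>. V i \<noteq> topspace (fst i)}" m UNIV]
      rev_finite_subset[OF V(3), of "{i \<in> \<F>. V i \<noteq> topspace (fst i)}"] \<F>_def by blast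
  \<comment> \<open>Inserting 0 gives the maximum a meaning when no factor is constrained.\<close>
  define l where "l = Max (insert 0 N)"
  have l: "n \<le> l" if "n \<in> N" for n
    using that N(1) by (auto simp: l_def)
  have "\<forall>n\<in>N. \<exists>G. openin (fst (m l)) G \<and>
      {y \<in> topspace X. snd (m l) y \<in> G} = {y \<in> topspace X. snd (m n) y \<in> V (m n)}"
  proof
    fix n assume "n \<in> N"
    from map_prec_open_preimage[OF prec[OF l[OF this]] surj V(2)[rule_format]]
    show "\<exists>G. openin (fst (m l)) G \<and>
      {y \<in> topspace X. snd (m l) y \<in> G} = {y \<in> topspace X. snd (m n) y \<in> V (m n)}"
      by blast
  qed
  from bchoice[OF this] obtain G where G0: "\<forall>n\<in>N. openin (fst (m l)) (G n) \<and>
      {y \<in> topspace X. snd (m l) y \<in> G n} = {y \<in> topspace X. snd (m n) y \<in> V (m n)}" ..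
  then have G: "\<And>n. n \<in> N \<Longrightarrow> openin (fst (m l)) (G n)"
    "\<And>n y. n \<in> N \<Longrightarrow> y \<in> topspace X \<Longrightarrow> snd (m l) y \<in> G n \<longleftrightarrow> snd (m n) y \<in> V (m n)"
    by auto
  \<comment> \<open>The factor \<open>topspace\<close> serves the case of empty \<open>N\<close>,
    where the bare intersection would be the whole type.\<close>
  let ?G = "topspace (fst (m l)) \<inter> \<Inter> (G ` N)"
  have oG: "openin (fst (m l)) ?G"
  proof (cases "N = {}")
    case False
    then have "openin (fst (m l)) (\<Inter> (G ` N))"
      using N G by (intro openin_Inter) auto
    then show ?thesis
      by auto
  qed auto
  have mem: "?d y \<in> Pi\<^sub>E \<F> V \<longleftrightarrow> snd (m l) y \<in> ?G" if y: "y \<in> topspace X" for y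
  proof -
    have "snd (m l) y \<in> ?G \<longleftrightarrow> (\<forall>n\<in>N. snd (m n) y \<in> V (m n))"
      using y G(2)[OF _ y] surj[of l] by auto
    also have "\<dots> \<longleftrightarrow> (\<forall>i\<in>m ` N. snd i y \<in> V i)"
      by auto
    also have "\<dots> \<longleftrightarrow> (\<forall>i\<in>\<F>. snd i y \<in> V i)"
    proof (intro iffI ballI)
      fix i assume i: "\<forall>i\<in>m ` N. snd i y \<in> V i" "i \<in> \<F>"
      then have "snd i y \<in> topspace (fst i)"
        using surj y by (auto simp: \<F>_def)
      then show "snd i y \<in> V i"
      proof (cases "V i = topspace (fst i)")
        case False
        then have "i \<in> m ` N"
          unfolding N(2)[symmetric] using i(2) by blast
        then show ?thesis
          using i(1) by blast
      qed simp
    next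
      fix i assume "\<forall>i\<in>\<F>. snd i y \<in> V i" "i \<in> m ` N"
      then show "snd i y \<in> V i"
        by (auto simp: \<F>_def)
    qed
    finally show ?thesis
      by (auto simp: PiE_iff)
  qed
  have "x \<in> topspace X"
    using x UX by blast
  moreover from this have "snd (m l) x \<in> ?G"
    using V(1) by (rule mem[THEN iffD1])
  ultimately have ne: "{y \<in> topspace X. snd (m l) y \<in> ?G} \<noteq> {}"
    by blast
  \<comment> \<open>A diagonal value in the basic set is sent by \<open>h\<close> into the image of
    \<open>U\<close> under \<open>\<psi>\<close>. As \<open>h\<close> is injective, the value is the
    diagonal of some \<open>u\<close> in \<open>U\<close>, so all coordinates agree.\<close>
  have lift: "\<exists>u\<in>U. snd (m k) u = snd (m k) y" if y: "y \<in> topspace X" "snd (m l) y \<in> ?G" for y k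
  proof -
    have "?d y \<in> O'"
      using mem[OF y(1)] y(2) V(4) by (meson subsetD)
    then have "?d y \<in> {z \<in> topspace ?S. h z \<in> \<psi> ` U}"
      unfolding O'(2) using y(1) by (intro IntI imageI)
    then have "h (?d y) \<in> \<psi> ` U"
      by simp
    then obtain u where u: "u \<in> U" "h (?d y) = \<psi> u"
      by blast
    then have "h (?d y) = h (?d u)"
      using h(2)[of u] UX by auto
    have "inj_on h (?d ` topspace X)"
      using h(1) top homeomorphic_imp_injective_map by metis
    then have "?d y = ?d u"
      using u(1) y(1) UX \<open>h (?d y) = h (?d u)\<close>
      by (intro inj_onD[of h "?d ` topspace X"]) auto
    then have "?d y (m k) = ?d u (m k)"
      by simp
    then show ?thesis
      using u(1) by (auto simp: \<F>_def)
  qed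
  show thesis
    by (rule that[OF oG ne lift])
qed

text \<open>Complete regularity, applied to a point of \<open>U\<close> and the complement of
  \<open>U\<close>. Non-empty open sets can thus be shrunk to sets controlled by a single real
  function, which can be adjoined to a map or to an index set of functions.\<close>

lemma cozero_subset:
  assumes "completely_regular_space X" "openin X U" "U \<noteq> {}"
  obtains h where "continuous_map X euclideanreal h" "{x \<in> topspace X. h x < 1} \<noteq> {}"
    "{x \<in> topspace X. h x < 1} \<subseteq> U"
proof -
  obtain x where x: "x \<in> U"
    using assms(3) by blast
  then have "closedin X (topspace X - U)" "x \<in> topspace X - (topspace X - U)"
    using assms(2) openin_subset by fastforce+
  then obtain h where h: "continuous_map X euclideanreal h" "h x = 0" "h ` (topspace X - U) \<subseteq> {1}"
    using assms(1) unfolding completely_regular_space_alt by blast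
  moreover have "x \<in> {x \<in> topspace X. h x < 1}"
    using h(2) \<open>x \<in> topspace X - (topspace X - U)\<close> by auto
  moreover have "{x \<in> topspace X. h x < 1} \<subseteq> U"
    using h(3) by force
  ultimately show thesis
    using that[of h] by blast
qed

text \<open>Pair \<open>\<phi>\<close> with a sequence of real functions that cut out cozero sets
  inside the members of \<open>D\<close>. The pair still takes values in a second countable
  Hausdorff space, so some open map of countable weight lies below it, and the cozero sets are
  preimages of open sets under that map.\<close>

lemma lattice_open_maps_refine:
  fixes X :: "'a topology"
  assumes "compactum X" and lat: "lattice_of_open_maps X \<Psi>"
    and W: "(W, \<phi>) \<in> \<Psi>" "second_countable W"
    and D: "countable D" "\<And>U. U \<in> D \<Longrightarrow> openin X U \<and> U \<noteq> {}"
  obtains W' \<phi>' where "(W', \<phi>') \<in> \<Psi>" "second_countable W'" "map_prec X W' \<phi>' W \<phi>"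
    "\<forall>U\<in>D. \<exists>G. openin W' G \<and> {x \<in> topspace X. \<phi>' x \<in> G} \<noteq> {}
        \<and> {x \<in> topspace X. \<phi>' x \<in> G} \<subseteq> U"
proof -
  have cr: "completely_regular_space X"
    using assms(1) compactum_imp_tychonoff tychonoff_space_def by blast
  \<comment> \<open>Continuity is demanded for all \<open>U\<close>, with a constant function as
    witness outside \<open>D\<close>, because the enumeration of an empty \<open>D\<close> returns
    an unspecified set.\<close>
  have "\<forall>U. \<exists>h. continuous_map X euclideanreal h \<and>
      (U \<in> D \<longrightarrow> {x \<in> topspace X. h x < 1} \<noteq> {} \<and> {x \<in> topspace X. h x < 1} \<subseteq> U)"
  proof
    fix U
    show "\<exists>h. continuous_map X euclideanreal h \<and>
      (U \<in> D \<longrightarrow> {x \<in> topspace X. h x < 1} \<noteq> {} \<and> {x \<in> topspace X. h x < 1} \<subseteq> U)"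
    proof (cases "U \<in> D")
      case True
      obtain h where "continuous_map X euclideanreal h" "{x \<in> topspace X. h x < 1} \<noteq> {}"
        "{x \<in> topspace X. h x < 1} \<subseteq> U"
        by (rule cozero_subset[OF cr]) (use D(2)[OF True] in auto)
      then show ?thesis
        by blast
    qed (auto intro: exI[of _ "\<lambda>_. 0"])
  qed
  from choice[OF this] obtain h where
    h0: "\<forall>U. continuous_map X euclideanreal (h U) \<and>
      (U \<in> D \<longrightarrow> {x \<in> topspace X. h U x < 1} \<noteq> {} \<and> {x \<in> topspace X. h U x < 1} \<subseteq> U)" ..
  have h: "continuous_map X euclideanreal (h U)" for U
    using h0 by (elim allE conjE)
  have coz: "{x \<in> topspace X. h U x < 1} \<noteq> {}" "{x \<in> topspace X. h U x < 1} \<subseteq> U" if "U \<in> D" for U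
    using h0[rule_format, of U] that by simp_all
  note onto = lattice_open_maps_member[OF lat]
  define K where "K = prod_topology W (euclidean :: (nat \<Rightarrow> real) topology)"
  define k where "k = (\<lambda>x. (\<phi> x, \<lambda>n. h (from_nat_into D n) x))"
  have "continuous_map X euclidean (\<lambda>x n. h (from_nat_into D n) x)"
    unfolding euclidean_product_topology[symmetric] continuous_map_componentwise_UNIV
    using h by (intro allI)
  then have k: "continuous_map X K k"
    unfolding K_def k_def using onto(1)[OF W(1)] by (simp add: continuous_map_paired)
  have "Hausdorff_space K"
    unfolding K_def using onto(3)[OF W(1)] by (simp add: Hausdorff_space_prod_topology)
  moreover have "second_countable K"
    unfolding K_def by (intro second_countable_prod_topology W(2) second_countable_euclidean)
  ultimately obtain W' \<phi>' where W': "(W', \<phi>') \<in> \<Psi>" "second_countable W'" "map_prec X W' \<phi>' K k"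
    using lattice_open_maps_factor[OF assms(1) lat k] by blast
  have "continuous_map K W fst"
    unfolding K_def by (rule continuous_map_fst)
  then have "map_prec X K k W \<phi>"
    unfolding map_prec_def
    by (intro exI[of _ fst])
      (auto simp: k_def continuous_map_in_subtopology continuous_map_from_subtopology)
  then have "map_prec X W' \<phi>' W \<phi>"
    using W'(3) map_prec_trans by blast
  moreover have "\<exists>G. openin W' G \<and> {x \<in> topspace X. \<phi>' x \<in> G} \<noteq> {}
        \<and> {x \<in> topspace X. \<phi>' x \<in> G} \<subseteq> U" if U: "U \<in> D" for U
  proof -
    obtain n where n: "from_nat_into D n = U"
      using from_nat_into_surj[OF D(1) U] by blast
    have "continuous_map K euclideanreal ((\<lambda>z. z n) \<circ> snd)"
      unfolding K_def by (rule continuous_map_compose[OF continuous_map_snd continuous_map_coordinate])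
    then have "openin K {z \<in> topspace K. ((\<lambda>z. z n) \<circ> snd) z \<in> {..<1}}"
      by (rule openin_continuous_map_preimage) simp
    from map_prec_open_preimage[OF W'(3) onto(2)[OF W'(1)] this]
    obtain G where G: "openin W' G" "{x \<in> topspace X. \<phi>' x \<in> G} =
        {x \<in> topspace X. k x \<in> {z \<in> topspace K. ((\<lambda>z. z n) \<circ> snd) z \<in> {..<1}}}"
      .
    have "{x \<in> topspace X. \<phi>' x \<in> G} = {x \<in> topspace X. h U x < 1}"
      unfolding G(2) using k by (auto simp: k_def n continuous_map_def)
    then show ?thesis
      using G(1) coz[OF U] by (intro exI[of _ G]) simp
  qed
  ultimately show thesis
    using that W' by blast
qed

text \<open>Choosing the open maps along finite lists makes every sequence of indices carry a
  decreasing sequence of open maps, to which the closure property of the lattice applies.\<close>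

lemma kappa_metrizable_regular_families:
  fixes X :: "'a topology" and D :: "'i list \<Rightarrow> 'a set set"
  assumes "kappa_metrizable_compactum X"
    and D: "\<And>xs. countable (D xs)" "\<And>xs U. U \<in> D xs \<Longrightarrow> openin X U \<and> U \<noteq> {}"
  obtains \<G> :: "'i list \<Rightarrow> 'a set set" where
    "\<forall>xs. countable (\<G> xs)" "\<forall>xs. \<forall>G\<in>\<G> xs. openin X G \<and> G \<noteq> {}"
    "\<forall>xs. \<forall>U\<in>D xs. \<exists>G\<in>\<G> xs. G \<subseteq> U"
    "\<forall>s U. (\<forall>n. \<exists>i. s (Suc n) = i # s n) \<longrightarrow> openin X U \<longrightarrow> U \<noteq> {} \<longrightarrow>
        (\<exists>n. \<exists>G\<in>\<G> (s n). \<forall>k. \<forall>G'\<in>\<G> (s k). G' \<subseteq> G \<longrightarrow> G' \<inter> U \<noteq> {})"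
proof -
  obtain \<Psi> where X: "compactum X" and lat: "lattice_of_open_maps X \<Psi>"
    using assms(1) unfolding kappa_metrizable_compactum_def by blast
  note onto = lattice_open_maps_member[OF lat]
  define pre :: "'a topology \<times> ('a \<Rightarrow> 'a) \<Rightarrow> 'a set \<Rightarrow> 'a set"
    where "pre = (\<lambda>m G. {x \<in> topspace X. snd m x \<in> G})"
  define P where "P = {m \<in> \<Psi>. second_countable (fst m)}"
  define T where "T = (\<lambda>xs (m :: 'a topology \<times> ('a \<Rightarrow> 'a)) m'. m' \<in> P \<and> map_prec X (fst m') (snd m') (fst m) (snd m) \<and>
      (\<forall>U\<in>D xs. \<exists>G. openin (fst m') G \<and> pre m' G \<noteq> {} \<and> pre m' G \<subseteq> U))"
  have step: "\<exists>m'. T xs m m'" if m: "m \<in> P" for xs m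
  proof -
    have m': "(fst m, snd m) \<in> \<Psi>" "second_countable (fst m)"
      using m by (auto simp: P_def)
    from lattice_open_maps_refine[OF X lat m' D(1)[where xs = xs] D(2)[where xs = xs]]
    obtain W' \<phi>' where "(W', \<phi>') \<in> \<Psi>" "second_countable W'" "map_prec X W' \<phi>' (fst m) (snd m)"
      "\<forall>U\<in>D xs. \<exists>G. openin W' G \<and> {x \<in> topspace X. \<phi>' x \<in> G} \<noteq> {}
        \<and> {x \<in> topspace X. \<phi>' x \<in> G} \<subseteq> U"
      .
    then have "T xs m (W', \<phi>')"
      by (auto simp: T_def P_def pre_def)
    then show ?thesis ..
  qed
  \<comment> \<open>A constant map is factored just to produce some member of the lattice of
    countable weight, where the recursion can start.\<close>
  have "continuous_map X euclideanreal (\<lambda>_. 0)"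
    by simp
  then obtain W0 \<phi>0 where "(W0, \<phi>0) \<in> \<Psi>" "second_countable W0"
    using lattice_open_maps_factor[OF X lat] Hausdorff_space_euclidean second_countable_euclidean
    by metis
  then have m0: "(W0, \<phi>0) \<in> P"
    by (simp add: P_def)
  \<comment> \<open>The map of \<open>x # xs\<close> is chosen below that of \<open>xs\<close>, so
    lists growing at the head carry a decreasing sequence of maps.\<close>
  define M where "M = rec_list (SOME m. T [] (W0, \<phi>0) m) (\<lambda>x xs m. SOME m'. T (x # xs) m m')"
  have M_Cons: "M (x # xs) = (SOME m'. T (x # xs) (M xs) m')" for x xs
    by (simp add: M_def)
  have "\<exists>m\<in>P. T xs m (M xs)" for xs
  proof (induction xs)
    case Nil
    show ?case
      using m0 someI_ex[OF step[OF m0]] by (auto simp: M_def)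
  next
    case (Cons x xs)
    then have "M xs \<in> P"
      by (auto simp: T_def)
    then have "T (x # xs) (M xs) (M (x # xs))"
      unfolding M_Cons by (rule someI_ex[OF step])
    with \<open>M xs \<in> P\<close> show ?case ..
  qed
  then have MP: "M xs \<in> P"
    and Mref: "\<And>U. U \<in> D xs \<Longrightarrow> \<exists>G. openin (fst (M xs)) G \<and> pre (M xs) G \<noteq> {} \<and> pre (M xs) G \<subseteq> U"
    for xs
    unfolding T_def by blast+
  have Mdec: "map_prec X (fst (M (x # xs))) (snd (M (x # xs))) (fst (M xs)) (snd (M xs))" for x xs
  proof -
    have "T (x # xs) (M xs) (M (x # xs))"
      unfolding M_Cons by (rule someI_ex[OF step[OF MP]])
    then show ?thesis
      by (simp add: T_def)
  qed
  have M\<Psi>: "M xs \<in> \<Psi>" for xs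
    using MP by (simp add: P_def)
  have "\<exists>\<B>. countable \<B> \<and> base_of (fst (M xs)) \<B>" for xs
    using MP[of xs] second_countable_iff_base_of by (auto simp: P_def)
  then obtain \<B> where \<B>: "\<And>xs. countable (\<B> xs)" "\<And>xs. base_of (fst (M xs)) (\<B> xs)"
    by metis
  have small: "\<exists>V\<in>\<B> xs. pre (M xs) V \<noteq> {} \<and> V \<subseteq> G"
    if G: "openin (fst (M xs)) G" "pre (M xs) G \<noteq> {}" for xs G
  proof -
    obtain x where x: "x \<in> topspace X" "snd (M xs) x \<in> G"
      using G(2) by (auto simp: pre_def)
    then obtain V where "V \<in> \<B> xs" "snd (M xs) x \<in> V" "V \<subseteq> G"
      using \<B>(2)[of xs] G(1) unfolding base_of_def by blast
    then show ?thesis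
      using x by (auto simp: pre_def)
  qed
  define \<G> where "\<G> = (\<lambda>xs. pre (M xs) ` \<B> xs - {{}})"
  show thesis
  proof (rule that[of \<G>]; (intro allI ballI impI)?)
    show "countable (\<G> xs)" for xs
      using \<B>(1) by (simp add: \<G>_def)
    show "openin X G \<and> G \<noteq> {}" if G: "G \<in> \<G> xs" for xs G
    proof -
      obtain V where "V \<in> \<B> xs" "G = pre (M xs) V"
        using G by (auto simp: \<G>_def)
      moreover have "continuous_map X (fst (M xs)) (snd (M xs))"
        using onto(1)[of "fst (M xs)" "snd (M xs)"] M\<Psi>[of xs] by simp
      ultimately show ?thesis
        using \<B>(2)[of xs] G unfolding base_of_def pre_def \<G>_def
        by (auto intro: openin_continuous_map_preimage)
    qed
    show "\<exists>G\<in>\<G> xs. G \<subseteq> U" if U: "U \<in> D xs" for xs U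
    proof -
      obtain G where G: "openin (fst (M xs)) G" "pre (M xs) G \<noteq> {}" "pre (M xs) G \<subseteq> U"
        using Mref[OF U] by blast
      then obtain V where "V \<in> \<B> xs" "pre (M xs) V \<noteq> {}" "V \<subseteq> G"
        using small by blast
      then have "pre (M xs) V \<in> \<G> xs" "pre (M xs) V \<subseteq> U"
        using G(3) by (auto simp: \<G>_def pre_def)
      then show ?thesis ..
    qed
    fix s :: "nat \<Rightarrow> 'i list" and U
    assume s: "\<forall>n. \<exists>i. s (Suc n) = i # s n" and U: "openin X U" "U \<noteq> {}"
    have "map_prec X (fst (M (s (Suc n)))) (snd (M (s (Suc n)))) (fst (M (s n))) (snd (M (s n)))" for n
      using s[rule_format, of n] Mdec by force
    then obtain n G where G: "openin (fst (M (s n))) G" "pre (M (s n)) G \<noteq> {}"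
      "\<And>x k. x \<in> topspace X \<Longrightarrow> snd (M (s n)) x \<in> G \<Longrightarrow> \<exists>u\<in>U. snd (M (s k)) u = snd (M (s k)) x"
      using lattice_open_maps_sequence[OF X lat, of "\<lambda>n. M (s n)", OF M\<Psi> _ U] unfolding pre_def by blast
    then obtain V where V: "V \<in> \<B> (s n)" "pre (M (s n)) V \<noteq> {}" "V \<subseteq> G"
      using small by blast
    \<comment> \<open>\<open>G'\<close> is a full preimage under \<open>M (s k)\<close>. It has a
      point \<open>y\<close> over \<open>G\<close>, hence it also contains the point of
      \<open>U\<close> with the same value as \<open>y\<close>.\<close>
    have "G' \<inter> U \<noteq> {}" if G': "G' \<in> \<G> (s k)" "G' \<subseteq> pre (M (s n)) V" for k G'
    proof -
      obtain H where H: "G' = pre (M (s k)) H" "G' \<noteq> {}"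
        using G'(1) by (auto simp: \<G>_def)
      then obtain y where y: "y \<in> G'"
        by blast
      then have "y \<in> topspace X" "snd (M (s n)) y \<in> G"
        using G'(2) V(3) by (auto simp: pre_def)
      then obtain u where "u \<in> U" "snd (M (s k)) u = snd (M (s k)) y"
        using G(3) by blast
      moreover have "u \<in> topspace X"
        using \<open>u \<in> U\<close> U(1) openin_subset by blast
      ultimately have "u \<in> G' \<inter> U"
        using y by (simp add: H pre_def)
      then show ?thesis
        by blast
    qed
    then show "\<exists>n. \<exists>G\<in>\<G> (s n). \<forall>k. \<forall>G'\<in>\<G> (s k). G' \<subseteq> G \<longrightarrow> G' \<inter> U \<noteq> {}"
      using V by (intro exI[of _ n] bexI[of _ "pre (M (s n)) V"]) (auto simp: \<G>_def)
  qed
qed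

section \<open>Skeletal diagonal maps\<close>

abbreviation real_maps :: "'b topology \<Rightarrow> ('b \<Rightarrow> real) set" where
  "real_maps Y \<equiv> {h. continuous_map Y euclideanreal h}"

text \<open>The diagonal product of a countable non-empty \<open>\<alpha>\<close>, encoded through
  its enumeration so that all images lie in one type, the one prescribed in
  \<open>skeletally_generated\<close>. A finite \<open>\<alpha>\<close> merely repeats a
  member.\<close>

definition diag_map :: "('b \<Rightarrow> real) set \<Rightarrow> 'b \<Rightarrow> nat \<Rightarrow> real" where
  "diag_map \<alpha> y = (\<lambda>n. from_nat_into \<alpha> n y)"

definition diag_space :: "'b topology \<Rightarrow> ('b \<Rightarrow> real) set \<Rightarrow> (nat \<Rightarrow> real) topology" where
  "diag_space Y \<alpha> = subtopology euclidean (diag_map \<alpha> ` topspace Y)"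

lemma topspace_diag_space [simp]: "topspace (diag_space Y \<alpha>) = diag_map \<alpha> ` topspace Y"
  by (simp add: diag_space_def)

lemma continuous_map_diag_map:
  assumes "\<alpha> \<subseteq> real_maps Y" "\<alpha> \<noteq> {}"
  shows "continuous_map Y (diag_space Y \<alpha>) (diag_map \<alpha>)"
proof -
  have "continuous_map Y euclidean (diag_map \<alpha>)"
    unfolding euclidean_product_topology[symmetric] continuous_map_componentwise_UNIV
    using assms from_nat_into[OF assms(2)] by (auto simp: diag_map_def)
  then show ?thesis
    by (simp add: diag_space_def continuous_map_in_subtopology)
qed

text \<open>For a base \<open>\<B>\<close> of the line this is the usual base of the coarsest
  topology making the members of \<open>H\<close> continuous. It consists of subsets of
  \<open>Y\<close>, independent of any enumeration of \<open>H\<close>, so it can be attached to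
  finite lists before a countable set of functions is fixed.\<close>

definition cylinders :: "'b topology \<Rightarrow> ('b \<Rightarrow> real) set \<Rightarrow> real set set \<Rightarrow> 'b set set" where
  "cylinders Y H \<B> =
     (\<lambda>J. {y \<in> topspace Y. \<forall>(h, B)\<in>J. h y \<in> B}) ` {J. finite J \<and> J \<subseteq> H \<times> \<B>}"

lemma countable_cylinders:
  assumes "countable H" "countable \<B>"
  shows "countable (cylinders Y H \<B>)"
  unfolding cylinders_def using assms by (intro countable_image countable_Collect_finite_subset) auto

lemma openin_cylinder:
  assumes "H \<subseteq> real_maps Y" "\<And>B. B \<in> \<B> \<Longrightarrow> open B" "C \<in> cylinders Y H \<B>"
  shows "openin Y C"
proof -
  obtain J where J: "finite J" "J \<subseteq> H \<times> \<B>" "C = {y \<in> topspace Y. \<forall>(h, B)\<in>J. h y \<in> B}"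
    using assms(3) by (auto simp: cylinders_def)
  have "openin Y {y \<in> topspace Y. \<forall>(h, B)\<in>J. h y \<in> B}"
    using J(1,2)
  proof (induction J)
    case (insert j J)
    obtain h B where j: "j = (h, B)"
      by fastforce
    then have "openin Y {y \<in> topspace Y. h y \<in> B}"
      using insert.prems assms(1,2) by (auto intro: openin_continuous_map_preimage)
    then have "openin Y ({y \<in> topspace Y. h y \<in> B} \<inter> {y \<in> topspace Y. \<forall>(h, B)\<in>J. h y \<in> B})"
      using insert by (intro openin_Int) auto
    moreover have "{y \<in> topspace Y. h y \<in> B} \<inter> {y \<in> topspace Y. \<forall>(h, B)\<in>J. h y \<in> B}
        = {y \<in> topspace Y. \<forall>(h, B)\<in>insert j J. h y \<in> B}"
      using j by auto
    ultimately show ?case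
      by simp
  qed simp
  then show ?thesis
    using J(3) by simp
qed

text \<open>A basic open set of the product constrains finitely many coordinates, all below some
  \<open>k\<close>. Open sets of the image are thereby caught by initial segments of the enumeration
  of \<open>\<alpha>\<close>.\<close>

lemma diag_space_contains_cylinder:
  assumes "topological_basis \<B>" "openin (diag_space Y \<alpha>) V" "V \<noteq> {}"
  obtains k C where "C \<in> cylinders Y (from_nat_into \<alpha> ` {..<k}) \<B>" "C \<noteq> {}"
    "\<forall>y\<in>C. diag_map \<alpha> y \<in> V"
proof -
  obtain T where T: "open T" "V = T \<inter> diag_map \<alpha> ` topspace Y"
    using assms(2) unfolding diag_space_def openin_subtopology by auto
  obtain y0 where y0: "y0 \<in> topspace Y" "diag_map \<alpha> y0 \<in> T"
    using assms(3) T by blast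
  have "openin (product_topology (\<lambda>i::nat. euclideanreal) UNIV) T"
    using T(1) by (simp add: euclidean_product_topology)
  from product_topology_open_contains_basis[OF this y0(2)]
  obtain G where G: "diag_map \<alpha> y0 \<in> Pi\<^sub>E UNIV G" "\<forall>i. openin euclideanreal (G i)"
    "finite {i. G i \<noteq> topspace euclideanreal}" "Pi\<^sub>E UNIV G \<subseteq> T"
    by (elim exE conjE)
  have "\<forall>i. \<exists>B. B \<in> \<B> \<and> from_nat_into \<alpha> i y0 \<in> B \<and> B \<subseteq> G i"
  proof
    fix i
    have "open (G i)" "from_nat_into \<alpha> i y0 \<in> G i"
      using G(1,2) by (auto simp: PiE_iff diag_map_def)
    from topological_basisE[OF assms(1) this]
    obtain B where "B \<in> \<B>" "from_nat_into \<alpha> i y0 \<in> B" "B \<subseteq> G i" .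
    then show "\<exists>B. B \<in> \<B> \<and> from_nat_into \<alpha> i y0 \<in> B \<and> B \<subseteq> G i"
      by blast
  qed
  from choice[OF this] obtain B
    where "\<forall>i. B i \<in> \<B> \<and> from_nat_into \<alpha> i y0 \<in> B i \<and> B i \<subseteq> G i" ..
  then have B: "B i \<in> \<B>" "from_nat_into \<alpha> i y0 \<in> B i" "B i \<subseteq> G i" for i
    by simp_all
  define I where "I = {i. G i \<noteq> UNIV}"
  have "finite I"
    using G(3) by (simp add: I_def)
  then obtain k where k: "I \<subseteq> {..<k}"
    using finite_nat_bounded by blast
  define J where "J = (\<lambda>i. (from_nat_into \<alpha> i, B i)) ` I"
  let ?C = "{y \<in> topspace Y. \<forall>(h, B)\<in>J. h y \<in> B}"
  have "finite J" "J \<subseteq> (from_nat_into \<alpha> ` {..<k}) \<times> \<B>"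
    using \<open>finite I\<close> k B(1) by (auto simp: J_def)
  then have "?C \<in> cylinders Y (from_nat_into \<alpha> ` {..<k}) \<B>"
    by (auto simp: cylinders_def)
  moreover have "y0 \<in> ?C"
    using y0(1) B(2) by (auto simp: J_def)
  moreover have "\<forall>y\<in>?C. diag_map \<alpha> y \<in> V"
  proof
    fix y assume y: "y \<in> ?C"
    have "from_nat_into \<alpha> i y \<in> G i" for i
    proof (cases "i \<in> I")
      case True
      then show ?thesis
        using y B(3) by (auto simp: J_def)
    qed (simp add: I_def)
    then have "diag_map \<alpha> y \<in> T"
      using G(4) by (auto simp: diag_map_def PiE_iff)
    then show "diag_map \<alpha> y \<in> V"
      using T(2) y by blast
  qed
  ultimately show thesis
    by (intro that[of ?C k]) auto
qed

lemma openin_diag_space_coordinate: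
  assumes "open B"
  shows "openin (diag_space Y \<alpha>) {z \<in> diag_map \<alpha> ` topspace Y. z n \<in> B}"
proof -
  have "continuous_map (diag_space Y \<alpha>) euclideanreal (\<lambda>z. z n)"
    unfolding diag_space_def by (intro continuous_map_from_subtopology continuous_map_coordinate)
  from openin_continuous_map_preimage[OF this, of B] show ?thesis
    using assms by simp
qed

text \<open>The non-empty open sets of \<open>X\<close> pull back to a pi-base of \<open>E\<close>.
  Two such maps on one \<open>E\<close> allow small open sets to be exchanged between their
  images.\<close>

definition pi_irreducible_map :: "'e topology \<Rightarrow> 'a topology \<Rightarrow> ('e \<Rightarrow> 'a) \<Rightarrow> bool" where
  "pi_irreducible_map E X f \<longleftrightarrow> continuous_map E X f \<and> f ` topspace E = topspace X \<and>
     (\<forall>O'. openin E O' \<and> O' \<noteq> {} \<longrightarrow>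
        (\<exists>U. openin X U \<and> U \<noteq> {} \<and> {e \<in> topspace E. f e \<in> U} \<subseteq> O'))"

text \<open>Removing \<open>O'\<close> leaves a proper closed set, whose image is closed and, by
  irreducibility, not everything. The complement of that image pulls back into
  \<open>O'\<close>.\<close>

lemma pi_irreducible_mapI:
  assumes "closed_map E X f" "irreducible_map E X f"
  shows "pi_irreducible_map E X f"
  unfolding pi_irreducible_map_def
proof (intro conjI allI impI)
  show "continuous_map E X f" and onto: "f ` topspace E = topspace X"
    using assms(2) by (simp_all add: irreducible_map_def)
  fix O' assume O': "openin E O' \<and> O' \<noteq> {}"
  let ?C = "topspace E - O'"
  have C: "closedin E ?C"
    using O' by blast
  then have "closedin X (f ` ?C)"
    using assms(1) by (simp add: closed_map_def)
  moreover have "f ` ?C \<noteq> topspace X"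
  proof
    assume "f ` ?C = topspace X"
    moreover have "\<forall>C. closedin E C \<and> f ` C = topspace X \<longrightarrow> C = topspace E"
      using assms(2) unfolding irreducible_map_def by (elim conjE)
    ultimately have "?C = topspace E"
      using C by blast
    then show False
      using O' openin_subset by fastforce
  qed
  moreover have "f ` ?C \<subseteq> topspace X"
    using onto by auto
  ultimately show "\<exists>U. openin X U \<and> U \<noteq> {} \<and> {e \<in> topspace E. f e \<in> U} \<subseteq> O'"
    by (intro exI[of _ "topspace X - f ` ?C"]) auto
qed

text \<open>The families on \<open>X\<close> supply a set \<open>G\<close> on which \<open>U\<close>
  is unavoidable; closure under \<open>F\<close> puts into \<open>\<alpha>\<close> a function that
  makes \<open>G\<close> visible in \<open>diag_space Y \<alpha>\<close>. The initial segments of an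
  enumeration of \<open>\<alpha>\<close> are lists over \<open>\<alpha>\<close>, so closure covers
  the whole sequence of families at once.\<close>

lemma skeletal_diag_map_club:
  fixes X :: "'a topology" and Y :: "'b topology"
  assumes "kappa_metrizable_compactum X" "completely_regular_space Y"
    and "pi_irreducible_map E X f" "pi_irreducible_map E Y g"
  obtains F :: "('b \<Rightarrow> real) list \<Rightarrow> ('b \<Rightarrow> real) set" where
    "\<forall>xs. countable (F xs)" "\<forall>xs. F xs \<subseteq> real_maps Y"
    "\<forall>\<alpha>. \<alpha> \<subseteq> real_maps Y \<longrightarrow> countable \<alpha> \<longrightarrow> \<alpha> \<noteq> {} \<longrightarrow> (\<forall>xs\<in>lists \<alpha>. F xs \<subseteq> \<alpha>)
        \<longrightarrow> skeletal_map Y (diag_space Y \<alpha>) (diag_map \<alpha>)"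
proof -
  let ?pf = "\<lambda>U. {e \<in> topspace E. f e \<in> U}" and ?pg = "\<lambda>U. {e \<in> topspace E. g e \<in> U}"
  have f: "continuous_map E X f" "f ` topspace E = topspace X"
    "\<And>O'. openin E O' \<Longrightarrow> O' \<noteq> {} \<Longrightarrow> \<exists>U. openin X U \<and> U \<noteq> {} \<and> ?pf U \<subseteq> O'"
    using assms(3) unfolding pi_irreducible_map_def by blast+
  have g: "continuous_map E Y g" "g ` topspace E = topspace Y"
    "\<And>O'. openin E O' \<Longrightarrow> O' \<noteq> {} \<Longrightarrow> \<exists>U. openin Y U \<and> U \<noteq> {} \<and> ?pg U \<subseteq> O'"
    using assms(4) unfolding pi_irreducible_map_def by blast+
  have pf: "openin E (?pf U)" "?pf U \<noteq> {}" if U: "openin X U" "U \<noteq> {}" for U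
  proof -
    show "openin E (?pf U)"
      using f(1) U(1) by (rule openin_continuous_map_preimage)
    obtain x where "x \<in> U"
      using U(2) by blast
    moreover have "x \<in> f ` topspace E"
      using \<open>x \<in> U\<close> U(1) f(2) openin_subset by blast
    ultimately show "?pf U \<noteq> {}"
      by auto
  qed
  have pg: "openin E (?pg U)" "?pg U \<noteq> {}" if U: "openin Y U" "U \<noteq> {}" for U
  proof -
    show "openin E (?pg U)"
      using g(1) U(1) by (rule openin_continuous_map_preimage)
    obtain x where "x \<in> U"
      using U(2) by blast
    moreover have "x \<in> g ` topspace E"
      using \<open>x \<in> U\<close> U(1) g(2) openin_subset by blast
    ultimately show "?pg U \<noteq> {}"
      by auto
  qed
  \<comment> \<open>From \<open>Y\<close> to \<open>X\<close>: \<open>u V\<close> has its preimage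
    in \<open>E\<close> inside that of \<open>V\<close>. It turns cylinders into sets which families
    on \<open>X\<close> can refine.\<close>
  have "\<forall>V. \<exists>U. openin Y V \<and> V \<noteq> {} \<longrightarrow> openin X U \<and> U \<noteq> {} \<and> ?pf U \<subseteq> ?pg V"
  proof
    fix V
    show "\<exists>U. openin Y V \<and> V \<noteq> {} \<longrightarrow> openin X U \<and> U \<noteq> {} \<and> ?pf U \<subseteq> ?pg V"
    proof (cases "openin Y V \<and> V \<noteq> {}")
      case True
      then show ?thesis
        using f(3)[OF pg, of V] by blast
    qed blast
  qed
  from choice[OF this] obtain u where
    u: "\<forall>V. openin Y V \<and> V \<noteq> {} \<longrightarrow> openin X (u V) \<and> u V \<noteq> {} \<and> ?pf (u V) \<subseteq> ?pg V" ..
  let ?coz = "\<lambda>h. {y \<in> topspace Y. h y < (1::real)}"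
  \<comment> \<open>From \<open>X\<close> to \<open>Y\<close>: the set where \<open>hh G\<close> is
    below 1 has its preimage in \<open>E\<close> inside that of \<open>G\<close>. The constant
    default keeps every value of \<open>hh\<close> a real map.\<close>
  have "\<forall>G. \<exists>h. continuous_map Y euclideanreal h \<and>
      (openin X G \<and> G \<noteq> {} \<longrightarrow> ?coz h \<noteq> {} \<and> ?pg (?coz h) \<subseteq> ?pf G)"
  proof
    fix G
    show "\<exists>h. continuous_map Y euclideanreal h \<and>
      (openin X G \<and> G \<noteq> {} \<longrightarrow> ?coz h \<noteq> {} \<and> ?pg (?coz h) \<subseteq> ?pf G)"
    proof (cases "openin X G \<and> G \<noteq> {}")
      case True
      then obtain U where U: "openin Y U" "U \<noteq> {}" "?pg U \<subseteq> ?pf G"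
        using g(3)[OF pf, of G] by blast
      from cozero_subset[OF assms(2) U(1,2)]
      obtain h where "continuous_map Y euclideanreal h" "?coz h \<noteq> {}" "?coz h \<subseteq> U" .
      with U(3) show ?thesis
        by (intro exI[of _ h]) blast
    next
      case False
      then show ?thesis
        by (intro exI[of _ "\<lambda>_. 0"]) auto
    qed
  qed
  from choice[OF this] obtain hh where hh0: "\<forall>G. continuous_map Y euclideanreal (hh G) \<and>
      (openin X G \<and> G \<noteq> {} \<longrightarrow> ?coz (hh G) \<noteq> {} \<and> ?pg (?coz (hh G)) \<subseteq> ?pf G)" ..
  then have hh: "continuous_map Y euclideanreal (hh G)"
    "openin X G \<and> G \<noteq> {} \<Longrightarrow> ?coz (hh G) \<noteq> {} \<and> ?pg (?coz (hh G)) \<subseteq> ?pf G" for G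
    by blast+
  obtain \<B> :: "real set set" where \<B>: "countable \<B>" "topological_basis \<B>"
    using ex_countable_basis by blast
  define D where "D = (\<lambda>xs. u ` {C \<in> cylinders Y (set xs) \<B>. openin Y C \<and> C \<noteq> {}})"
  have "countable (D xs)" for xs
    unfolding D_def using countable_cylinders[of "set xs" \<B> Y] \<B>(1)
    by (intro countable_image) (auto intro: countable_subset countable_finite)
  moreover have "openin X U \<and> U \<noteq> {}" if "U \<in> D xs" for U xs
    using that u by (auto simp: D_def)
  ultimately obtain \<G> :: "('b \<Rightarrow> real) list \<Rightarrow> 'a set set" where
    \<G>0: "\<forall>xs. countable (\<G> xs)" "\<forall>xs. \<forall>G\<in>\<G> xs. openin X G \<and> G \<noteq> {}"
    "\<forall>xs. \<forall>U\<in>D xs. \<exists>G\<in>\<G> xs. G \<subseteq> U"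
    "\<forall>s U. (\<forall>n. \<exists>i. s (Suc n) = i # s n) \<longrightarrow> openin X U \<longrightarrow> U \<noteq> {} \<longrightarrow>
        (\<exists>n. \<exists>G\<in>\<G> (s n). \<forall>k. \<forall>G'\<in>\<G> (s k). G' \<subseteq> G \<longrightarrow> G' \<inter> U \<noteq> {})"
    by (rule kappa_metrizable_regular_families[OF assms(1)])
  note \<G> = \<G>0[rule_format]
  show thesis
  proof (rule that[of "\<lambda>xs. hh ` \<G> xs"]; (intro allI impI)?)
    show "countable (hh ` \<G> xs)" for xs
      using \<G>(1) by simp
    show "hh ` \<G> xs \<subseteq> real_maps Y" for xs
      using hh(1) by auto
    fix \<alpha> :: "('b \<Rightarrow> real) set"
    assume \<alpha>: "\<alpha> \<subseteq> real_maps Y" "countable \<alpha>" "\<alpha> \<noteq> {}"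
      and closed: "\<forall>xs\<in>lists \<alpha>. hh ` \<G> xs \<subseteq> \<alpha>"
    let ?q = "diag_map \<alpha>" and ?Z = "diag_space Y \<alpha>"
    \<comment> \<open>Reversal puts the newest function at the head, the end at which the lists of a
      sequence have to grow.\<close>
    define s where "s = (\<lambda>n. rev (map (from_nat_into \<alpha>) [0..<n]))"
    have s: "\<exists>i. s (Suc n) = i # s n" "set (s n) = from_nat_into \<alpha> ` {..<n}" "s n \<in> lists \<alpha>" for n
      using from_nat_into[OF \<alpha>(3)] by (auto simp: s_def)
    show "skeletal_map Y ?Z ?q"
      unfolding skeletal_map_def
    proof (intro conjI allI impI)
      show "continuous_map Y ?Z ?q"
        using \<alpha> by (rule_tac continuous_map_diag_map)
      fix U assume U: "openin Y U \<and> U \<noteq> {}"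
      obtain U' where U': "openin X U'" "U' \<noteq> {}" "?pf U' \<subseteq> ?pg U"
        using f(3)[OF pg, of U] U by blast
      from \<G>(4)[of s, OF s(1) U'(1,2)]
      obtain n G where G: "G \<in> \<G> (s n)"
        "\<forall>k. \<forall>G'\<in>\<G> (s k). G' \<subseteq> G \<longrightarrow> G' \<inter> U' \<noteq> {}"
        by (elim exE bexE)
      have hG: "?coz (hh G) \<noteq> {}" "?pg (?coz (hh G)) \<subseteq> ?pf G"
        using hh(2)[OF \<G>(2)[OF G(1)]] by simp_all
      have "hh G \<in> \<alpha>"
        using closed[rule_format, OF s(3)] G(1) by blast
      then obtain j where j: "from_nat_into \<alpha> j = hh G"
        using from_nat_into_surj[OF \<alpha>(2)] by blast
      \<comment> \<open>The coordinate of \<open>hh G\<close> makes \<open>?V\<close> a witness for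
        the interior: it remains to see that the image of \<open>U\<close> is dense in this open
        set.\<close>
      let ?V = "{z \<in> ?q ` topspace Y. z j \<in> {..<1}}"
      have V: "openin ?Z ?V"
        by (rule openin_diag_space_coordinate) simp
      obtain y where "y \<in> ?coz (hh G)"
        using hG(1) by blast
      then have "?q y \<in> ?V"
        by (auto simp: diag_map_def j)
      have "?V \<subseteq> ?Z closure_of (?q ` U)"
      proof
        fix z assume z: "z \<in> ?V"
        have "\<exists>w\<in>?q ` U. w \<in> T" if T: "z \<in> T" "openin ?Z T" for T
        proof -
          have "openin ?Z (?V \<inter> T)" "?V \<inter> T \<noteq> {}"
            using V T z by blast+
          from diag_space_contains_cylinder[OF \<B>(2) this]
          obtain k C where C: "C \<in> cylinders Y (from_nat_into \<alpha> ` {..<k}) \<B>" "C \<noteq> {}"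
            "\<forall>y\<in>C. ?q y \<in> ?V \<inter> T"
            .
          have "from_nat_into \<alpha> ` {..<k} \<subseteq> real_maps Y"
            using from_nat_into[OF \<alpha>(3)] \<alpha>(1) by blast
          then have oC: "openin Y C"
            using openin_cylinder C(1) topological_basis_open[OF \<B>(2)] by blast
          then have "u C \<in> D (s k)"
            using C(1,2) by (simp add: D_def s(2))
          then obtain G' where G': "G' \<in> \<G> (s k)" "G' \<subseteq> u C"
            using \<G>(3) by blast
          have fG': "g e \<in> C" if "e \<in> topspace E" "f e \<in> G'" for e
            using u[rule_format, OF conjI[OF oC C(2)]] G'(2) that by blast
          \<comment> \<open>A point of \<open>G'\<close> is \<open>f e\<close> for some
            \<open>e\<close>. Then \<open>g e\<close> lies in the cylinder, so \<open>hh G\<close>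
            is below 1 there, and the choice of \<open>hh\<close> returns \<open>f e\<close> to
            \<open>G\<close>.\<close>
          have "G' \<subseteq> G"
          proof
            fix x assume x: "x \<in> G'"
            have "G' \<subseteq> topspace X"
              using \<G>(2)[OF G'(1)] openin_subset by blast
            then have "x \<in> f ` topspace E"
              unfolding f(2) using x by (rule subsetD)
            then obtain e where e: "e \<in> topspace E" "f e = x"
              by blast
            then have "?q (g e) \<in> ?V"
              using fG' x C(3) by blast
            moreover have "g e \<in> topspace Y"
              using e(1) unfolding g(2)[symmetric] by (rule imageI)
            ultimately have "e \<in> ?pg (?coz (hh G))"
              using e(1) by (simp add: diag_map_def j)
            then show "x \<in> G"
              using hG(2) e by blast
          qed
          \<comment> \<open>Now \<open>G'\<close> must meet \<open>U'\<close>. A common point,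
            lifted to \<open>E\<close> and sent to \<open>Y\<close>, lies both in \<open>U\<close>
            and in the cylinder, so its diagonal value lies in \<open>T\<close>.\<close>
          then obtain x where x: "x \<in> G'" "x \<in> U'"
            using G(2)[rule_format, OF G'(1)] by blast
          then have "x \<in> f ` topspace E"
            unfolding f(2) using openin_subset[OF U'(1)] by blast
          then obtain e where e: "e \<in> topspace E" "f e = x"
            by blast
          then have "g e \<in> U" "g e \<in> C"
            using U'(3) x fG' by blast+
          then show ?thesis
            using C(3) by blast
        qed
        then show "z \<in> ?Z closure_of (?q ` U)"
          using z by (simp add: in_closure_of)
      qed
      then have "?V \<subseteq> ?Z interior_of (?Z closure_of (?q ` U))"
        using V by (rule interior_of_maximal)
      then show "?Z interior_of (?Z closure_of (?q ` U)) \<noteq> {}"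
        using \<open>?q y \<in> ?V\<close> by blast
    qed
  qed
qed

section \<open>The inverse system of countable sets of functions\<close>

text \<open>The projection that forgets the functions outside \<open>\<alpha>\<close>. As the two
  enumerations are unrelated, coordinate \<open>n\<close> is read at some position where
  \<open>\<beta>\<close> lists the \<open>n\<close>-th function of \<open>\<alpha>\<close>.\<close>

definition bond :: "('b \<Rightarrow> real) set \<Rightarrow> ('b \<Rightarrow> real) set \<Rightarrow> (nat \<Rightarrow> real) \<Rightarrow> nat \<Rightarrow> real" where
  "bond \<alpha> \<beta> z = (\<lambda>n. z (SOME k. from_nat_into \<beta> k = from_nat_into \<alpha> n))"

lemma bond_diag_map:
  assumes "\<alpha> \<subseteq> \<beta>" "\<alpha> \<noteq> {}" "countable \<beta>"
  shows "bond \<alpha> \<beta> (diag_map \<beta> y) = diag_map \<alpha> y"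
proof
  fix n
  have "from_nat_into \<alpha> n \<in> \<beta>"
    using assms(1) from_nat_into[OF assms(2)] by blast
  then have "\<exists>k. from_nat_into \<beta> k = from_nat_into \<alpha> n"
    using from_nat_into_surj[OF assms(3)] by blast
  then have "from_nat_into \<beta> (SOME k. from_nat_into \<beta> k = from_nat_into \<alpha> n) = from_nat_into \<alpha> n"
    by (rule someI_ex)
  then show "bond \<alpha> \<beta> (diag_map \<beta> y) n = diag_map \<alpha> y n"
    by (simp add: bond_def diag_map_def)
qed

lemma continuous_map_bond:
  assumes "\<alpha> \<subseteq> \<beta>" "\<alpha> \<noteq> {}" "countable \<beta>"
  shows "continuous_map (diag_space Y \<beta>) (diag_space Y \<alpha>) (bond \<alpha> \<beta>)"
proof -
  have "continuous_map euclidean (product_topology (\<lambda>i::nat. euclideanreal) UNIV) (bond \<alpha> \<beta>)"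
    unfolding continuous_map_componentwise_UNIV bond_def by (intro allI continuous_map_coordinate)
  then have "continuous_map (diag_space Y \<beta>) euclidean (bond \<alpha> \<beta>)"
    unfolding euclidean_product_topology diag_space_def by (rule continuous_map_from_subtopology)
  moreover have "bond \<alpha> \<beta> ` diag_map \<beta> ` topspace Y \<subseteq> diag_map \<alpha> ` topspace Y"
    using bond_diag_map[OF assms] by auto
  ultimately show ?thesis
    unfolding diag_space_def[of Y \<alpha>] by (auto simp: continuous_map_in_subtopology)
qed

lemma diag_map_eq_iff:
  assumes "countable \<alpha>" "\<alpha> \<noteq> {}"
  shows "diag_map \<alpha> y = diag_map \<alpha> y' \<longleftrightarrow> (\<forall>h\<in>\<alpha>. h y = h y')"
proof -
  have "\<alpha> = range (from_nat_into \<alpha>)"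
    using assms by (simp add: range_from_nat_into)
  then show ?thesis
    unfolding diag_map_def fun_eq_iff by (metis rangeE rangeI)
qed

text \<open>As \<open>q\<close> is onto, an open \<open>U\<close> is the image of its preimage, so
  \<open>p\<close> on \<open>U\<close> and the composite on that preimage have the same image. This
  passes skeletality from diagonal maps to bonding maps.\<close>

lemma skeletal_map_factor:
  assumes "continuous_map Y Z q" "q ` topspace Y = topspace Z" "continuous_map Z W p"
    and "skeletal_map Y W (\<lambda>y. p (q y))"
  shows "skeletal_map Z W p"
  unfolding skeletal_map_def
proof (intro conjI allI impI)
  fix U assume U: "openin Z U \<and> U \<noteq> {}"
  let ?V = "{y \<in> topspace Y. q y \<in> U}"
  have UZ: "U \<subseteq> q ` topspace Y"
    using U openin_subset assms(2) by blast
  then have img: "q ` ?V = U"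
    by blast
  have "openin Y ?V"
    using assms(1) U by (blast intro: openin_continuous_map_preimage)
  moreover have "?V \<noteq> {}"
    using img U by blast
  ultimately have "W interior_of (W closure_of ((\<lambda>y. p (q y)) ` ?V)) \<noteq> {}"
    using assms(4) by (simp add: skeletal_map_def)
  moreover have "(\<lambda>y. p (q y)) ` ?V = p ` U"
    using img by (metis image_image)
  ultimately show "W interior_of (W closure_of (p ` U)) \<noteq> {}"
    by simp
qed (fact assms(3))

text \<open>Inclusion orders the index set and unions are the suprema of countable chains. The
  spaces \<open>diag_space Y \<alpha>\<close> with \<open>\<alpha>\<close> in \<open>A\<close> are
  compact Hausdorff, so both embeddings, of a term into the limit of a sequence and of
  \<open>Y\<close> into the full limit, reduce to continuity and injectivity.\<close>

lemma skeletally_generatedI: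
  fixes Y :: "'b topology" and A :: "('b \<Rightarrow> real) set set"
  assumes Y: "compactum Y"
    and A: "\<And>\<alpha>. \<alpha> \<in> A \<Longrightarrow> \<alpha> \<subseteq> real_maps Y \<and> countable \<alpha> \<and> \<alpha> \<noteq> {}"
    and cofinal: "\<And>B. B \<subseteq> real_maps Y \<Longrightarrow> countable B \<Longrightarrow> \<exists>\<alpha>\<in>A. B \<subseteq> \<alpha>"
    and chain: "\<And>C. C \<subseteq> A \<Longrightarrow> countable C \<Longrightarrow> C \<noteq> {} \<Longrightarrow> (\<forall>\<alpha>\<in>C. \<forall>\<beta>\<in>C. \<alpha> \<subseteq> \<beta> \<or> \<beta> \<subseteq> \<alpha>)
        \<Longrightarrow> \<Union>C \<in> A"
    and skeletal: "\<And>\<alpha>. \<alpha> \<in> A \<Longrightarrow> skeletal_map Y (diag_space Y \<alpha>) (diag_map \<alpha>)"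
  shows "skeletally_generated Y"
proof -
  define r where "r = {(\<alpha>, \<beta>). \<alpha> \<in> A \<and> \<beta> \<in> A \<and> \<alpha> \<subseteq> \<beta>}"
  let ?X = "diag_space Y"
  have r: "(\<alpha>, \<beta>) \<in> r \<longleftrightarrow> \<alpha> \<in> A \<and> \<beta> \<in> A \<and> \<alpha> \<subseteq> \<beta>" for \<alpha> \<beta>
    by (simp add: r_def)
  have Asub: "\<alpha> \<subseteq> real_maps Y" and Acount: "countable \<alpha>" and Ane: "\<alpha> \<noteq> {}" if "\<alpha> \<in> A" for \<alpha>
    using A[OF that] by simp_all
  have cq: "continuous_map Y (?X \<alpha>) (diag_map \<alpha>)" if "\<alpha> \<in> A" for \<alpha>
    by (intro continuous_map_diag_map Asub Ane that)
  have bq: "bond \<alpha> \<beta> (diag_map \<beta> y) = diag_map \<alpha> y" if "(\<alpha>, \<beta>) \<in> r" for \<alpha> \<beta> y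
    using that Ane Acount by (intro bond_diag_map) (simp_all add: r)
  have cb: "continuous_map (?X \<beta>) (?X \<alpha>) (bond \<alpha> \<beta>)" if "(\<alpha>, \<beta>) \<in> r" for \<alpha> \<beta>
    using that Ane Acount by (intro continuous_map_bond) (simp_all add: r)
  have haus: "Hausdorff_space (?X \<alpha>)" for \<alpha>
    unfolding diag_space_def by (rule Hausdorff_space_subtopology) (rule Hausdorff_space_euclidean)
  have comp: "compact_space (?X \<alpha>)" if "\<alpha> \<in> A" for \<alpha>
    using image_compactin[OF _ cq[OF that], of "topspace Y"] Y
    by (simp add: compactum_def compact_space_def)
  have dir: "directed_order A r"
    unfolding directed_order_def
  proof (intro conjI ballI)
    show "partial_order_on A r"
      unfolding partial_order_on_def preorder_on_def
      by (auto simp: r_def refl_on_def trans_def antisym_def)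
    show "A \<noteq> {}"
      using cofinal[of "{}"] by auto
    fix \<alpha> \<beta> assume "\<alpha> \<in> A" "\<beta> \<in> A"
    then have "\<alpha> \<union> \<beta> \<subseteq> real_maps Y" "countable (\<alpha> \<union> \<beta>)"
      by (simp_all add: Un_least Asub Acount)
    from cofinal[OF this] obtain \<gamma> where "\<gamma> \<in> A" "\<alpha> \<union> \<beta> \<subseteq> \<gamma>" ..
    then show "\<exists>\<gamma>\<in>A. (\<alpha>, \<gamma>) \<in> r \<and> (\<beta>, \<gamma>) \<in> r"
      using \<open>\<alpha> \<in> A\<close> \<open>\<beta> \<in> A\<close> by (intro bexI[of _ \<gamma>]) (auto simp: r)
  qed
  have inv: "inverse_system A r ?X bond"
    unfolding inverse_system_def
  proof (intro conjI allI ballI impI)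
    show "directed_order A r"
      by (fact dir)
    show "continuous_map (?X \<beta>) (?X \<alpha>) (bond \<alpha> \<beta>)" if "(\<alpha>, \<beta>) \<in> r" for \<alpha> \<beta>
      using that by (rule cb)
    show "bond \<alpha> \<alpha> x = x" if "\<alpha> \<in> A" "x \<in> topspace (?X \<alpha>)" for \<alpha> x
      using that bq[of \<alpha> \<alpha>] by (auto simp: r)
    fix \<alpha> \<beta> \<gamma> x assume *: "(\<alpha>, \<beta>) \<in> r \<and> (\<beta>, \<gamma>) \<in> r" "x \<in> topspace (?X \<gamma>)"
    then have "(\<alpha>, \<gamma>) \<in> r"
      by (auto simp: r)
    with * show "bond \<alpha> \<gamma> x = bond \<alpha> \<beta> (bond \<beta> \<gamma> x)"
      using bq by auto
  qed
  have sup: "is_sup A r C (\<Union>C)" if "C \<subseteq> A" "C \<in> Chains r" "countable C" "C \<noteq> {}" for C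
  proof -
    have "\<Union>C \<in> A"
      using that(2) by (intro chain that) (auto simp: Chains_def r)
    then show ?thesis
      using that(1) by (auto simp: is_sup_def r)
  qed
  have seq: "embedding_map (?X \<beta>) (sequence_limit s ?X bond) (\<lambda>x n. bond (s n) \<beta> x) \<and>
        sequence_limit s ?X bond closure_of ((\<lambda>x n. bond (s n) \<beta> x) ` topspace (?X \<beta>))
          = topspace (sequence_limit s ?X bond)"
    if s: "range s \<subseteq> A" "\<forall>n. (s n, s (Suc n)) \<in> r" "is_sup A r (range s) \<beta>" for s \<beta>
  proof -
    let ?L = "sequence_limit s ?X bond" and ?i = "\<lambda>x n. bond (s n) \<beta> x"
    have \<beta>: "\<beta> \<in> A" and sr: "(s n, \<beta>) \<in> r" for n
      using s(3) by (auto simp: is_sup_def)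
    have smono: "(s m, s n) \<in> r" if "m \<le> n" for m n
      using that
    proof (induction n rule: dec_induct)
      case base
      show ?case using s(1) by (auto simp: r)
    next
      case (step n)
      then show ?case using s(2) r by (meson subset_trans)
    qed
    have ch: "range s \<in> Chains r"
      unfolding Chains_def using smono by (auto) (metis nat_le_linear)
    \<comment> \<open>The union is a supremum too, which identifies the given supremum
      \<open>\<beta>\<close> with it. Injectivity below rests on this: functions in
      \<open>\<beta>\<close> already occur in some \<open>s n\<close>.\<close>
    have "is_sup A r (range s) (\<Union>(range s))"
      using sup[OF s(1) ch] by simp
    then have "(\<beta>, \<Union>(range s)) \<in> r"
      using s(3) unfolding is_sup_def by blast
    moreover have "s n \<subseteq> \<beta>" for n
      using sr r by blast
    ultimately have \<beta>eq: "\<beta> = \<Union>(range s)"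
      unfolding r by blast
    have iq: "?i (diag_map \<beta> y) = (\<lambda>n. diag_map (s n) y)" for y
      using bq[OF sr] by simp
    have "continuous_map (?X \<beta>) ?L ?i"
      unfolding inverse_limit_def continuous_map_in_subtopology continuous_map_componentwise_UNIV
    proof (intro conjI allI)
      show "continuous_map (?X \<beta>) (?X (s n)) (\<lambda>x. bond (s n) \<beta> x)" for n
        using cb[OF sr] .
      show "?i \<in> topspace (?X \<beta>) \<rightarrow> {x. \<forall>m n. (m, n) \<in> {(m, n). m \<le> n} \<longrightarrow> bond (s m) (s n) (x n) = x m}"
        using bq[OF sr] bq[OF smono] by auto
    qed
    moreover have "inj_on ?i (topspace (?X \<beta>))"
    proof (rule inj_onI)
      fix x x' assume "x \<in> topspace (?X \<beta>)" "x' \<in> topspace (?X \<beta>)" and eq: "?i x = ?i x'"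
      then obtain y y' where y: "x = diag_map \<beta> y" "x' = diag_map \<beta> y'"
        by auto
      have "diag_map (s n) y = diag_map (s n) y'" for n
        using eq unfolding y iq by (rule fun_cong)
      moreover have "countable (s n)" "s n \<noteq> {}" for n
        using s(1) Acount Ane by blast+
      ultimately have "\<forall>h\<in>s n. h y = h y'" for n
        by (simp add: diag_map_eq_iff)
      then have "\<forall>h\<in>\<beta>. h y = h y'"
        unfolding \<beta>eq by blast
      then show "x = x'"
        unfolding y by (simp add: diag_map_eq_iff Acount[OF \<beta>] Ane[OF \<beta>])
    qed
    moreover have "Hausdorff_space ?L"
      unfolding inverse_limit_def
      by (rule Hausdorff_space_subtopology) (use haus in \<open>simp add: Hausdorff_space_product_topology\<close>)
    ultimately have emb: "embedding_map (?X \<beta>) ?L ?i"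
      using comp[OF \<beta>] by (intro continuous_imp_embedding_map)
    \<comment> \<open>A basic neighbourhood of \<open>z\<close> constrains only coordinates below
      some \<open>N\<close>. A point \<open>y\<close> over \<open>z N\<close> reproduces those,
      since the bonding maps compute them from the \<open>N\<close>-th.\<close>
    have "z \<in> ?L closure_of (?i ` topspace (?X \<beta>))" if z: "z \<in> topspace ?L" for z
      unfolding in_closure_of
    proof (intro conjI allI impI)
      show "z \<in> topspace ?L"
        by (fact z)
      fix T assume T: "z \<in> T \<and> openin ?L T"
      then obtain T' where T': "openin (product_topology (\<lambda>n. ?X (s n)) UNIV) T'"
        "T = T' \<inter> {x. \<forall>m n. (m, n) \<in> {(m, n). m \<le> n} \<longrightarrow> bond (s m) (s n) (x n) = x m}"
        unfolding inverse_limit_def openin_subtopology by blast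
      have "z \<in> T'"
        using T T'(2) by blast
      from product_topology_open_contains_basis[OF T'(1) this]
      obtain V where V: "z \<in> Pi\<^sub>E UNIV V" "\<forall>n. openin (?X (s n)) (V n)"
        "finite {n. V n \<noteq> topspace (?X (s n))}" "Pi\<^sub>E UNIV V \<subseteq> T'"
        by (elim exE conjE)
      obtain N where N: "{n. V n \<noteq> topspace (?X (s n))} \<subseteq> {..<N}"
        using finite_nat_bounded[OF V(3)] by blast
      have zb: "z N \<in> topspace (?X (s N))" "\<And>m. m \<le> N \<Longrightarrow> z m = bond (s m) (s N) (z N)"
        using z by (auto simp: inverse_limit_def PiE_iff simp del: topspace_diag_space)
      obtain y where y: "y \<in> topspace Y" "z N = diag_map (s N) y"
        using zb(1) unfolding topspace_diag_space by blast
      have "diag_map (s n) y \<in> V n" for n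
      proof (cases "n < N")
        case True
        then have "z n = diag_map (s n) y"
          using zb(2)[of n] y(2) bq[OF smono[of n N]] by simp
        then show ?thesis
          using V(1) by (metis PiE_mem UNIV_I)
      next
        case False
        then have "V n = topspace (?X (s n))"
          using N by auto
        then show ?thesis
          using y(1) by simp
      qed
      then have "(\<lambda>n. diag_map (s n) y) \<in> T'"
        using V(4) by (auto simp: PiE_iff)
      moreover have "(\<lambda>n. diag_map (s n) y) \<in> {x. \<forall>m n. (m, n) \<in> {(m, n). m \<le> n} \<longrightarrow> bond (s m) (s n) (x n) = x m}"
        using bq smono by simp
      ultimately have "?i (diag_map \<beta> y) \<in> T"
        unfolding iq T'(2) by (rule IntI)
      then show "\<exists>w. w \<in> ?i ` topspace (?X \<beta>) \<and> w \<in> T"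
        using y(1) by auto
    qed
    then have "?L closure_of (?i ` topspace (?X \<beta>)) = topspace ?L"
      by (intro subset_antisym closure_of_subset_topspace subsetI)
    with emb show ?thesis
      by (rule conjI)
  qed
  define e where "e = (\<lambda>y. \<lambda>\<alpha>\<in>A. diag_map \<alpha> y)"
  have e: "e y \<alpha> = diag_map \<alpha> y" if "\<alpha> \<in> A" for y \<alpha>
    using that by (simp add: e_def)
  have "embedding_map Y (inverse_limit A r ?X bond) e"
  proof (rule continuous_imp_embedding_map)
    have "continuous_map Y (product_topology ?X A) e"
      unfolding continuous_map_componentwise
    proof (intro conjI ballI)
      show "e ` topspace Y \<subseteq> extensional A"
        by (auto simp: e_def)
      show "continuous_map Y (?X \<alpha>) (\<lambda>y. e y \<alpha>)" if "\<alpha> \<in> A" for \<alpha>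
        using cq[OF that] by (simp add: e[OF that])
    qed
    then show "continuous_map Y (inverse_limit A r ?X bond) e"
      unfolding inverse_limit_def continuous_map_in_subtopology
      using bq by (auto simp: e_def r)
    show "compact_space Y"
      using Y by (simp add: compactum_def)
    show "Hausdorff_space (inverse_limit A r ?X bond)"
      unfolding inverse_limit_def
      by (rule Hausdorff_space_subtopology) (use haus in \<open>simp add: Hausdorff_space_product_topology\<close>)
    \<comment> \<open>Points of the compactum are separated by a real map, and cofinality makes that
      map a coordinate of some \<open>diag_map \<alpha>\<close>.\<close>
    show "inj_on e (topspace Y)"
    proof (rule inj_onI, rule ccontr)
      fix y y' assume y: "y \<in> topspace Y" "y' \<in> topspace Y" "e y = e y'" "y \<noteq> y'"
      have "closedin Y {y'}"
        using Y y(2) by (simp add: compactum_def closedin_Hausdorff_singleton)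
      moreover have "completely_regular_space Y"
        using compactum_imp_tychonoff[OF Y] by (simp add: tychonoff_space_def)
      moreover have "y \<in> topspace Y - {y'}"
        using y by simp
      ultimately obtain h where h: "continuous_map Y euclideanreal h" "h y = 0" "h ` {y'} \<subseteq> {1}"
        unfolding completely_regular_space_alt by blast
      then obtain \<alpha> where \<alpha>: "\<alpha> \<in> A" "{h} \<subseteq> \<alpha>"
        using cofinal[of "{h}"] by auto
      have "diag_map \<alpha> y = diag_map \<alpha> y'"
        using fun_cong[OF y(3), of \<alpha>] e[OF \<alpha>(1)] by simp
      then have "\<forall>k\<in>\<alpha>. k y = k y'"
        by (simp add: diag_map_eq_iff Acount[OF \<alpha>(1)] Ane[OF \<alpha>(1)])
      then have "h y = h y'"
        using \<alpha>(2) by blast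
      then show False
        using h(2,3) by simp
    qed
  qed
  moreover have "(\<lambda>y. e y \<alpha>) ` topspace Y = topspace (?X \<alpha>)" if "\<alpha> \<in> A" for \<alpha>
    using e[OF that] by simp
  moreover have "\<exists>\<alpha>\<in>A. map_prec Y (?X \<alpha>) (\<lambda>y. e y \<alpha>) euclideanreal f"
    if f: "continuous_map Y euclideanreal f" for f
  proof -
    \<comment> \<open>Once \<open>f\<close> belongs to \<open>\<alpha>\<close>, it factors through
      the diagonal map by a coordinate projection.\<close>
    obtain \<alpha> where \<alpha>: "\<alpha> \<in> A" "f \<in> \<alpha>"
      using cofinal[of "{f}"] f by auto
    then obtain n where n: "from_nat_into \<alpha> n = f"
      using from_nat_into_surj[OF Acount] by blast
    have "continuous_map (subtopology (?X \<alpha>) ((\<lambda>y. e y \<alpha>) ` topspace Y)) euclideanreal (\<lambda>z. z n)"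
      unfolding diag_space_def subtopology_subtopology
      by (intro continuous_map_from_subtopology continuous_map_coordinate)
    then have "continuous_map (subtopology (?X \<alpha>) ((\<lambda>y. e y \<alpha>) ` topspace Y))
        (subtopology euclideanreal (f ` topspace Y)) (\<lambda>z. z n)"
      by (auto simp: continuous_map_in_subtopology e[OF \<alpha>(1)] diag_map_def n)
    then have "map_prec Y (?X \<alpha>) (\<lambda>y. e y \<alpha>) euclideanreal f"
      unfolding map_prec_def by (intro exI[of _ "\<lambda>z. z n"]) (simp add: e[OF \<alpha>(1)] diag_map_def n)
    then show ?thesis
      using \<alpha>(1) by blast
  qed
  moreover have "metrizable_space (?X \<alpha>) \<and> separable_space (?X \<alpha>)" for \<alpha>
    unfolding diag_space_def
    by (intro conjI metrizable_space_subtopology metrizable_space_euclidean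
        second_countable_imp_separable_space second_countable_subtopology second_countable_euclidean)
  moreover have "bond \<alpha> \<beta> ` topspace (?X \<beta>) = topspace (?X \<alpha>) \<and> skeletal_map (?X \<beta>) (?X \<alpha>) (bond \<alpha> \<beta>)"
    if \<alpha>\<beta>: "(\<alpha>, \<beta>) \<in> r" for \<alpha> \<beta>
  proof
    show "bond \<alpha> \<beta> ` topspace (?X \<beta>) = topspace (?X \<alpha>)"
      using bq[OF \<alpha>\<beta>] by (simp add: image_image)
    have "\<alpha> \<in> A" "\<beta> \<in> A"
      using \<alpha>\<beta> by (simp_all add: r)
    then show "skeletal_map (?X \<beta>) (?X \<alpha>) (bond \<alpha> \<beta>)"
      using skeletal by (intro skeletal_map_factor[OF cq _ cb[OF \<alpha>\<beta>]]) (simp_all add: bq[OF \<alpha>\<beta>])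
  qed
  moreover have "sigma_complete A r"
    unfolding sigma_complete_def using sup by blast
  ultimately have "skeletally_generated_by Y A r ?X bond"
    unfolding skeletally_generated_by_def using inv seq
    by (intro conjI allI impI ballI exI[of _ e]) simp_all
  then show ?thesis
    unfolding skeletally_generated_def by (intro exI)
qed

section \<open>Closed sets of functions\<close>

text \<open>Iterate the closing step countably often. A list over the union has finitely many
  entries, so it lies over one stage, and its values arrive at the next; each stage is countable
  because lists over a countable set are.\<close>

lemma countable_closed_superset:
  assumes "countable B" "B \<subseteq> C" "\<And>xs. countable (F xs)" "\<And>xs. F xs \<subseteq> C"
  obtains \<alpha> where "B \<subseteq> \<alpha>" "\<alpha> \<subseteq> C" "countable \<alpha>" "\<forall>xs\<in>lists \<alpha>. F xs \<subseteq> \<alpha>"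
proof -
  define step where "step = (\<lambda>S. S \<union> (\<Union>xs\<in>lists S. F xs))"
  define S where "S n = (step ^^ n) B" for n
  have S: "S 0 = B" "S (Suc n) = S n \<union> (\<Union>xs\<in>lists (S n). F xs)" for n
    by (simp_all add: S_def step_def)
  have "countable (S n)" for n
    by (induction n) (use assms(1,3) in \<open>auto simp: S\<close>)
  moreover have "S n \<subseteq> C" for n
    by (induction n) (use assms(2,4) in \<open>auto simp: S\<close>)
  moreover have "F xs \<subseteq> (\<Union>n. S n)" if "xs \<in> lists (\<Union>n. S n)" for xs
  proof -
    have mono: "S m \<subseteq> S n" if "m \<le> n" for m n
      using that by (rule lift_Suc_mono_le[rotated]) (auto simp: S)
    have "\<exists>n. xs \<in> lists (S n)"
      using that
    proof (induction xs)
      case (Cons x xs)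
      then obtain m n where "xs \<in> lists (S n)" "x \<in> S m"
        by auto
      then have "x # xs \<in> lists (S (max m n))"
        using mono[of m "max m n"] lists_mono[OF mono[of n "max m n"]] by auto
      then show ?case ..
    qed simp
    then obtain n where "xs \<in> lists (S n)" ..
    then have "F xs \<subseteq> S (Suc n)"
      by (auto simp: S)
    then show ?thesis
      by blast
  qed
  moreover have "B \<subseteq> (\<Union>n. S n)"
    using S(1) by blast
  ultimately show thesis
    by (intro that[of "\<Union>n. S n"]) auto
qed

text \<open>Finitely many entries of a list fit into one member of a chain. Hence being closed under
  a function of lists survives unions of chains.\<close>

lemma lists_Union_chain:
  assumes "C \<noteq> {}" "\<forall>\<alpha>\<in>C. \<forall>\<beta>\<in>C. \<alpha> \<subseteq> \<beta> \<or> \<beta> \<subseteq> \<alpha>" "xs \<in> lists (\<Union>C)"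
  shows "\<exists>\<alpha>\<in>C. xs \<in> lists \<alpha>"
  using assms(3)
proof (induction xs)
  case Nil
  then show ?case
    using assms(1) by auto
next
  case (Cons x xs)
  then obtain \<alpha> \<beta> where \<alpha>\<beta>: "\<alpha> \<in> C" "xs \<in> lists \<alpha>" "\<beta> \<in> C" "x \<in> \<beta>"
    by auto
  then consider "\<alpha> \<subseteq> \<beta>" | "\<beta> \<subseteq> \<alpha>"
    using assms(2) by blast
  then show ?case
  proof cases
    case 1
    then show ?thesis
      using \<alpha>\<beta> lists_mono[OF 1] by (intro bexI[of _ \<beta>]) auto
  next
    case 2
    then show ?thesis
      using \<alpha>\<beta> by (intro bexI[of _ \<alpha>]) auto
  qed
qed

lemma skeletally_generated_if_pi_irreducible:
  fixes X :: "'a topology" and Y :: "'b topology"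
  assumes "kappa_metrizable_compactum X" "compactum Y"
    and "pi_irreducible_map E X f" "pi_irreducible_map E Y g"
  shows "skeletally_generated Y"
proof -
  have "completely_regular_space Y"
    using compactum_imp_tychonoff[OF assms(2)] by (simp add: tychonoff_space_def)
  from skeletal_diag_map_club[OF assms(1) this assms(3,4)]
  obtain F :: "('b \<Rightarrow> real) list \<Rightarrow> ('b \<Rightarrow> real) set" where
    F: "\<forall>xs. countable (F xs)" "\<forall>xs. F xs \<subseteq> real_maps Y"
    "\<forall>\<alpha>. \<alpha> \<subseteq> real_maps Y \<longrightarrow> countable \<alpha> \<longrightarrow> \<alpha> \<noteq> {} \<longrightarrow> (\<forall>xs\<in>lists \<alpha>. F xs \<subseteq> \<alpha>)
        \<longrightarrow> skeletal_map Y (diag_space Y \<alpha>) (diag_map \<alpha>)" .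
  define A where "A = {\<alpha>. \<alpha> \<subseteq> real_maps Y \<and> countable \<alpha> \<and> \<alpha> \<noteq> {} \<and> (\<forall>xs\<in>lists \<alpha>. F xs \<subseteq> \<alpha>)}"
  show ?thesis
  proof (rule skeletally_generatedI[OF assms(2), of A])
    show "\<alpha> \<subseteq> real_maps Y \<and> countable \<alpha> \<and> \<alpha> \<noteq> {}" if "\<alpha> \<in> A" for \<alpha>
      using that by (simp add: A_def)
    show "skeletal_map Y (diag_space Y \<alpha>) (diag_map \<alpha>)" if "\<alpha> \<in> A" for \<alpha>
      using that F(3) by (simp add: A_def)
    show "\<exists>\<alpha>\<in>A. B \<subseteq> \<alpha>" if B: "B \<subseteq> real_maps Y" "countable B" for B
    proof -
      \<comment> \<open>The zero function ensures that the closed superset is non-empty, even for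
        empty \<open>B\<close>.\<close>
      have B0: "countable (insert (\<lambda>_. 0) B)" "insert (\<lambda>_. 0) B \<subseteq> real_maps Y"
        using B by auto
      from countable_closed_superset[OF B0 F(1)[rule_format] F(2)[rule_format]]
      obtain \<alpha> where "insert (\<lambda>_. 0) B \<subseteq> \<alpha>" "\<alpha> \<subseteq> real_maps Y" "countable \<alpha>"
        "\<forall>xs\<in>lists \<alpha>. F xs \<subseteq> \<alpha>" .
      then have "\<alpha> \<in> A" "B \<subseteq> \<alpha>"
        by (auto simp: A_def)
      then show ?thesis ..
    qed
    fix C assume C: "C \<subseteq> A" "countable C" "C \<noteq> {}" "\<forall>\<alpha>\<in>C. \<forall>\<beta>\<in>C. \<alpha> \<subseteq> \<beta> \<or> \<beta> \<subseteq> \<alpha>"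
    have A: "\<alpha> \<subseteq> real_maps Y" "countable \<alpha>" "\<alpha> \<noteq> {}" "\<forall>xs\<in>lists \<alpha>. F xs \<subseteq> \<alpha>" if "\<alpha> \<in> C" for \<alpha>
      using that C(1) unfolding A_def by blast+
    have "F xs \<subseteq> \<Union>C" if xs: "xs \<in> lists (\<Union>C)" for xs
    proof -
      obtain \<alpha> where "\<alpha> \<in> C" "xs \<in> lists \<alpha>"
        using lists_Union_chain[OF C(3,4) xs] by blast
      then show ?thesis
        using A(4) by blast
    qed
    moreover have "\<Union>C \<subseteq> real_maps Y"
      using A(1) by (rule Union_least)
    moreover have "countable (\<Union>C)"
      using countable_UN[of C "\<lambda>\<alpha>. \<alpha>"] C(2) A(2) by simp
    moreover have "\<Union>C \<noteq> {}"
      using C(3) A(3) by blast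
    ultimately show "\<Union>C \<in> A"
      unfolding A_def by blast
  qed
qed

section \<open>Transfer along the homeomorphism of the absolutes\<close>

lemma irreducible_map_compose_homeomorphic:
  assumes "homeomorphic_map E' E h" "irreducible_map E Y g"
  shows "irreducible_map E' Y (g \<circ> h)"
proof -
  have h: "continuous_map E' E h" "closed_map E' E h" "h ` topspace E' = topspace E"
    "inj_on h (topspace E')"
    using assms(1) by (simp_all add: homeomorphic_imp_continuous_map homeomorphic_imp_closed_map
        homeomorphic_imp_surjective_map homeomorphic_imp_injective_map)
  have g: "continuous_map E Y g" "g ` topspace E = topspace Y"
    "\<And>C. closedin E C \<Longrightarrow> g ` C = topspace Y \<Longrightarrow> C = topspace E"
    using assms(2) unfolding irreducible_map_def by blast+
  show ?thesis
    unfolding irreducible_map_def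
  proof (intro conjI allI impI)
    show "continuous_map E' Y (g \<circ> h)"
      using h(1) g(1) by (rule continuous_map_compose)
    show "(g \<circ> h) ` topspace E' = topspace Y"
      by (simp only: image_comp[symmetric] h(3) g(2))
    fix C assume C: "closedin E' C \<and> (g \<circ> h) ` C = topspace Y"
    then have "h ` C = topspace E"
      using h(2) by (intro g(3)) (simp_all add: closed_map_def image_comp)
    then have "h ` C = h ` topspace E'"
      using h(3) by simp
    moreover have "C \<subseteq> topspace E'"
      using C closedin_subset by blast
    ultimately show "C = topspace E'"
      by (simp add: inj_on_image_eq_iff[OF h(4)])
  qed
qed

theorem corollary2p5:
  fixes X :: "'a topology" and Y :: "'b topology"
    and aX :: "'c topology" and aY :: "'d topology"
  assumes "kappa_metrizable_compactum X"
    and "tychonoff_space Y"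
    and "is_absolute_of aX X" and "is_absolute_of aY Y"
    and "aX homeomorphic_space aY"
  shows "skeletally_generated Y"
proof -
  obtain f where f: "perfect_map aX X f" "irreducible_map aX X f"
    using assms(3) unfolding is_absolute_of_def by blast
  obtain g where g: "perfect_map aY Y g" "irreducible_map aY Y g"
    using assms(4) unfolding is_absolute_of_def by blast
  obtain h where h: "homeomorphic_map aX aY h"
    using assms(5) homeomorphic_space by blast
  have pf: "proper_map aX X f" "f ` topspace aX = topspace X"
    and pg: "proper_map aY Y g" "continuous_map aY Y g" "g ` topspace aY = topspace Y"
    using f(1) g(1) by (simp_all add: perfect_map_def)
  \<comment> \<open>Compactness climbs from \<open>X\<close> to its absolute along the proper map,
    crosses the homeomorphism and descends to \<open>Y\<close> as a continuous image.\<close>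
  have "compact_space X"
    using assms(1) by (simp add: kappa_metrizable_compactum_def compactum_def)
  then have "compact_space aX"
    by (rule compact_space_proper_map_preimage[OF pf])
  then have "compact_space aY"
    using assms(5) homeomorphic_compact_space by blast
  then have "compact_space Y"
    using image_compactin[OF _ pg(2), of "topspace aY"] pg(3) by (simp add: compact_space_def)
  then have "compactum Y"
    using assms(2) by (simp add: compactum_def tychonoff_space_def)
  \<comment> \<open>Perfect maps are closed, which turns irreducibility into the pi-base property;
    \<open>aX\<close> serves as the common domain.\<close>
  moreover have "pi_irreducible_map aX X f"
    using pf(1) f(2) by (intro pi_irreducible_mapI) (simp_all add: proper_map_def)
  moreover have "closed_map aX Y (g \<circ> h)"
    using homeomorphic_imp_closed_map[OF h] pg(1)[unfolded proper_map_def, THEN conjunct1]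
    by (rule closed_map_compose)
  then have "pi_irreducible_map aX Y (g \<circ> h)"
    using irreducible_map_compose_homeomorphic[OF h g(2)] by (rule pi_irreducible_mapI)
  ultimately show ?thesis
    by (rule skeletally_generated_if_pi_irreducible[OF assms(1)])
qed

end
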